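(* Let $\tilde G$ be the Heisenberg group of all real matrices $\begin{pmatrix}1&a&c\\0&1&b\\0&0&1\end{pmatrix}$ with $a,b,c\in\mathbb{R}$, let $H\subset\tilde G$ be the subgroup of those matrices with $a=b=0$ and $c\in\mathbb{Z}$, and let $G=\tilde G/H$. Then there exists a domain $D\subset\mathbb{C}^3$ of bounded type such that $\operatorname{Aut}(D)$ is isomorphic to $G$.
   Context: For a domain $D\subset\mathbb{C}^n$, $\operatorname{Aut}(D)$ denotes the group of all biholomorphic automorphisms of $D$. A domain $D\subset\mathbb{C}^n$ is of bounded type if it is biholomorphically equivalent to a bounded domain; for such $D$, $\operatorname{Aut}(D)$ is a real finite-dimensional Lie group by a theorem of H. Cartan. The group $G$ can be described equivalently as $\mathbb{R}\times\mathbb{R}\times\mathbb{T}$, where $\mathbb{T}\subset\mathbb{C}$ is the unit circle, with multiplication $(a,b,c)(x,y,z)=(a+x,\,b+y,\,cz\,e^{iay})$. *)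

theory Defs
  imports "HOL-Analysis.Analysis" "HOL-Algebra.Coset" "HOL-Algebra.Bij"
begin

subsection \<open>Holomorphic maps and domains in several complex variables\<close>

definition holomorphic_map_on ::
    "(complex ^ 'n \<Rightarrow> complex ^ 'm) \<Rightarrow> (complex ^ 'n) set \<Rightarrow> bool" where
  "holomorphic_map_on f D \<longleftrightarrow>
     (\<forall>z\<in>D. \<exists>L. Vector_Spaces.linear (*s) (*s) L \<and> (f has_derivative L) (at z within D))"

definition biholomorphic_map ::
    "(complex ^ 'n) set \<Rightarrow> (complex ^ 'n) set \<Rightarrow> (complex ^ 'n \<Rightarrow> complex ^ 'n) \<Rightarrow> bool" where
  "biholomorphic_map D E f \<longleftrightarrow>
     bij_betw f D E \<and> holomorphic_map_on f D \<and> holomorphic_map_on (inv_into D f) E"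

definition complex_domain :: "(complex ^ 'n) set \<Rightarrow> bool" where
  "complex_domain D \<longleftrightarrow> open D \<and> connected D \<and> D \<noteq> {}"

definition domain_of_bounded_type :: "(complex ^ 'n) set \<Rightarrow> bool" where
  "domain_of_bounded_type D \<longleftrightarrow> complex_domain D \<and>
     (\<exists>E f. complex_domain E \<and> bounded E \<and> biholomorphic_map D E f)"

subsection \<open>The automorphism group of a domain\<close>

text \<open>Automorphisms are taken to be extensional, so that they are determined by their
  values on \<open>D\<close>; multiplication is composition on \<open>D\<close>.\<close>

definition aut_group :: "(complex ^ 'n) set \<Rightarrow> (complex ^ 'n \<Rightarrow> complex ^ 'n) monoid" where
  "aut_group D = (BijGroup D)\<lparr>carrier := {f \<in> extensional D. biholomorphic_map D D f}\<rparr>"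

text \<open>The compact-open topology. For a domain of bounded type it is the topology underlying
  Cartan's Lie group structure.\<close>

definition aut_topology :: "(complex ^ 'n) set \<Rightarrow> (complex ^ 'n \<Rightarrow> complex ^ 'n) topology" where
  "aut_topology D = topology_generated_by
     {{f \<in> carrier (aut_group D). f ` K \<subseteq> U} | K U. compact K \<and> K \<subseteq> D \<and> open U}"

lemma topspace_aut_topology [simp]: "topspace (aut_topology D) = carrier (aut_group D)"
proof -
  have "\<exists>K U. carrier (aut_group D) = {f \<in> carrier (aut_group D). f ` K \<subseteq> U}
           \<and> compact K \<and> K \<subseteq> D \<and> open U"
    by (intro exI[of _ "{}"]) auto
  then show ?thesis
    unfolding aut_topology_def topology_generated_by_topspace by blast
qed

lemma holomorphic_map_on_compose:
  assumes "holomorphic_map_on f D" "holomorphic_map_on g E" "f ` D \<subseteq> E"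
  shows "holomorphic_map_on (g \<circ> f) D"
  unfolding holomorphic_map_on_def
proof
  fix z assume z: "z \<in> D"
  obtain L where L: "Vector_Spaces.linear (*s) (*s) L" "(f has_derivative L) (at z within D)"
    using assms(1) z unfolding holomorphic_map_on_def by blast
  obtain M where M: "Vector_Spaces.linear (*s) (*s) M" "(g has_derivative M) (at (f z) within E)"
    using assms(2,3) z unfolding holomorphic_map_on_def by blast
  have "(g \<circ> f has_derivative M \<circ> L) (at z within D)"
    using diff_chain_within[OF L(2)] M(2) assms(3) has_derivative_subset by blast
  moreover have "Vector_Spaces.linear (*s) (*s) (M \<circ> L)"
    using L(1) M(1) Vector_Spaces.linear_compose by blast
  ultimately show "\<exists>L. Vector_Spaces.linear (*s) (*s) L \<and>
      (g \<circ> f has_derivative L) (at z within D)" by blast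
qed

lemma holomorphic_map_on_cong:
  assumes "\<And>z. z \<in> D \<Longrightarrow> f z = g z"
  shows "holomorphic_map_on f D \<longleftrightarrow> holomorphic_map_on g D"
  unfolding holomorphic_map_on_def using assms
  by (metis has_derivative_transform)

lemma holomorphic_map_on_id: "holomorphic_map_on (\<lambda>z. z) D"
  unfolding holomorphic_map_on_def
  by (auto intro!: exI[of _ "\<lambda>z. z"] vec.linear_ident)

lemma group_aut_group: "group (aut_group D)"
proof -
  let ?A = "{f \<in> extensional D. biholomorphic_map D D f}"
  have Bij: "?A \<subseteq> Bij D"
    by (auto simp: Bij_def biholomorphic_map_def)
  have inv_cong: "holomorphic_map_on (inv_into D g) D"
    if "bij_betw g D D" "holomorphic_map_on h D" "\<And>z. z \<in> D \<Longrightarrow> h z \<in> D \<and> g (h z) = z" for g h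
    using that holomorphic_map_on_cong[of D h "inv_into D g"]
    by (metis bij_betw_inv_into_left)
  interpret B: group "BijGroup D" by (rule group_BijGroup)
  have "subgroup ?A (BijGroup D)"
  proof (rule B.subgroupI)
    show "?A \<subseteq> carrier (BijGroup D)" using Bij by (simp add: BijGroup_def)
    have 0: "bij_betw (\<lambda>x\<in>D. x) D D" by (auto simp: bij_betw_def inj_on_def)
    have 1: "holomorphic_map_on (\<lambda>x\<in>D. x) D"
      using holomorphic_map_on_cong[of D "\<lambda>x\<in>D. x" "\<lambda>x. x"] holomorphic_map_on_id by auto
    have "holomorphic_map_on (inv_into D (\<lambda>x\<in>D. x)) D"
      using inv_cong[OF 0 1] by simp
    with 0 1 have "(\<lambda>x\<in>D. x) \<in> ?A" by (simp add: biholomorphic_map_def)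
    then show "?A \<noteq> {}" by blast
  next
    fix f assume f: "f \<in> ?A"
    then have b: "bij_betw f D D" and fB: "f \<in> Bij D" using Bij by (auto simp: biholomorphic_map_def)
    let ?g = "\<lambda>x\<in>D. inv_into D f x"
    have g: "inv\<^bsub>BijGroup D\<^esub> f = ?g" using fB by (rule inv_BijGroup)
    have 1: "holomorphic_map_on ?g D"
      using f holomorphic_map_on_cong[of D ?g "inv_into D f"] by (auto simp: biholomorphic_map_def)
    have 2: "bij_betw ?g D D" using restrict_inv_into_Bij[OF fB] by (simp add: Bij_def)
    have 3: "holomorphic_map_on f D" using f by (auto simp: biholomorphic_map_def)
    have "holomorphic_map_on (inv_into D ?g) D"
      using inv_cong[OF 2 3] b by (metis bij_betwE bij_betw_inv_into_left restrict_apply')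
    then show "inv\<^bsub>BijGroup D\<^esub> f \<in> ?A" using 1 2 g by (simp add: biholomorphic_map_def)
  next
    fix f g assume fg: "f \<in> ?A" "g \<in> ?A"
    have m: "f \<otimes>\<^bsub>BijGroup D\<^esub> g = compose D f g"
      using fg Bij by (auto simp: BijGroup_def)
    have b: "bij_betw f D D" "bij_betw g D D" using fg by (auto simp: biholomorphic_map_def)
    have im: "f ` D \<subseteq> D" "g ` D \<subseteq> D" using b by (auto simp: bij_betw_def)
    have b2: "bij_betw (compose D f g) D D" using b by (blast intro: bij_betw_compose)
    have "holomorphic_map_on (f \<circ> g) D"
      using fg im holomorphic_map_on_compose[of g D f D] by (auto simp: biholomorphic_map_def)
    then have h1: "holomorphic_map_on (compose D f g) D"
      using holomorphic_map_on_cong[of D "compose D f g" "f \<circ> g"] by (simp add: compose_def)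
    have imi: "inv_into D f ` D \<subseteq> D" using b by (metis bij_betw_def bij_betw_inv_into subset_refl)
    then have "holomorphic_map_on (inv_into D g \<circ> inv_into D f) D"
      using fg holomorphic_map_on_compose[of "inv_into D f" D "inv_into D g" D]
      by (auto simp: biholomorphic_map_def)
    then have "holomorphic_map_on (inv_into D (compose D f g)) D"
    proof (rule inv_cong[OF b2])
      fix z assume z: "z \<in> D"
      show "(inv_into D g \<circ> inv_into D f) z \<in> D \<and>
          compose D f g ((inv_into D g \<circ> inv_into D f) z) = z"
        using z b
        by (metis bij_betwE bij_betw_inv_into bij_betw_inv_into_right comp_apply compose_eq)
    qed
    then show "f \<otimes>\<^bsub>BijGroup D\<^esub> g \<in> ?A"
      using h1 b2 m by (simp add: biholomorphic_map_def)
  qed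
  then show ?thesis unfolding aut_group_def by (rule B.subgroup_imp_group)
qed

subsection \<open>The Heisenberg group and its quotient\<close>

definition heisenberg_matrix :: "real \<Rightarrow> real \<Rightarrow> real \<Rightarrow> real ^ 3 ^ 3" where
  "heisenberg_matrix a b c =
     vector [vector [1, a, c],
             vector [0, 1, b],
             vector [0, 0, 1]]"

definition heisenberg_group :: "(real ^ 3 ^ 3) monoid" where
  "heisenberg_group =
     \<lparr>carrier = {heisenberg_matrix a b c | a b c. True}, mult = (**), one = mat 1\<rparr>"

definition heisenberg_subgroup :: "(real ^ 3 ^ 3) set" where
  "heisenberg_subgroup = {heisenberg_matrix 0 0 c | c. c \<in> \<int>}"

definition G_group :: "(real ^ 3 ^ 3) set monoid" where
  "G_group = heisenberg_group Mod heisenberg_subgroup"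

definition quotient_topology :: "'a topology \<Rightarrow> ('a \<Rightarrow> 'b) \<Rightarrow> 'b topology" where
  "quotient_topology X q = topology (\<lambda>U. U \<subseteq> q ` topspace X \<and> openin X {x \<in> topspace X. q x \<in> U})"

definition G_topology :: "(real ^ 3 ^ 3) set topology" where
  "G_topology = quotient_topology (top_of_set (carrier heisenberg_group))
     (\<lambda>A. heisenberg_subgroup #>\<^bsub>heisenberg_group\<^esub> A)"

lemma openin_quotient_topology:
  "openin (quotient_topology X q) U \<longleftrightarrow>
     U \<subseteq> q ` topspace X \<and> openin X {x \<in> topspace X. q x \<in> U}"
proof -
  have "istopology (\<lambda>U. U \<subseteq> q ` topspace X \<and> openin X {x \<in> topspace X. q x \<in> U})"
    unfolding istopology_def
  proof (intro conjI allI impI)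
    fix S T
    assume S: "S \<subseteq> q ` topspace X \<and> openin X {x \<in> topspace X. q x \<in> S}"
      and T: "T \<subseteq> q ` topspace X \<and> openin X {x \<in> topspace X. q x \<in> T}"
    show "S \<inter> T \<subseteq> q ` topspace X" using S by blast
    have "{x \<in> topspace X. q x \<in> S \<inter> T} =
        {x \<in> topspace X. q x \<in> S} \<inter> {x \<in> topspace X. q x \<in> T}" by blast
    then show "openin X {x \<in> topspace X. q x \<in> S \<inter> T}" using S T by (simp add: openin_Int)
  next
    fix \<K> assume K: "\<forall>S\<in>\<K>. S \<subseteq> q ` topspace X \<and> openin X {x \<in> topspace X. q x \<in> S}"
    show "\<Union>\<K> \<subseteq> q ` topspace X" using K by blast
    have "{x \<in> topspace X. q x \<in> \<Union>\<K>} = (\<Union>S\<in>\<K>. {x \<in> topspace X. q x \<in> S})" by blast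
    then show "openin X {x \<in> topspace X. q x \<in> \<Union>\<K>}" using K by auto
  qed
  then show ?thesis unfolding quotient_topology_def by simp
qed

lemma topspace_quotient_topology [simp]: "topspace (quotient_topology X q) = q ` topspace X"
proof -
  have "{x \<in> topspace X. q x \<in> q ` topspace X} = topspace X" by blast
  then have "openin (quotient_topology X q) (q ` topspace X)"
    by (simp add: openin_quotient_topology)
  then show ?thesis
    by (metis openin_quotient_topology openin_subset openin_topspace subset_antisym)
qed

lemma quotient_map_quotient_topology: "quotient_map X (quotient_topology X q) q"
  by (auto simp: quotient_map_def openin_quotient_topology)

lemma topspace_G_topology [simp]: "topspace G_topology = carrier G_group"
  by (auto simp: G_topology_def G_group_def FactGroup_def RCOSETS_def)

lemma heisenberg_matrix_mult:
  "heisenberg_matrix a b c ** heisenberg_matrix x y z = heisenberg_matrix (a + x) (b + y) (c + z + a * y)"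
  by (simp add: heisenberg_matrix_def matrix_matrix_mult_def vec_eq_iff forall_3 sum_3)

lemma heisenberg_matrix_one: "heisenberg_matrix 0 0 0 = mat 1"
  by (simp add: heisenberg_matrix_def mat_def vec_eq_iff forall_3)

lemma group_heisenberg_group: "group heisenberg_group"
proof (rule groupI)
  fix A assume "A \<in> carrier heisenberg_group"
  then obtain a b c where A: "A = heisenberg_matrix a b c" by (auto simp: heisenberg_group_def)
  have "heisenberg_matrix (- a) (- b) (a * b - c) ** A = mat 1"
    by (simp add: A heisenberg_matrix_mult flip: heisenberg_matrix_one)
  then show "\<exists>B\<in>carrier heisenberg_group. B \<otimes>\<^bsub>heisenberg_group\<^esub> A = \<one>\<^bsub>heisenberg_group\<^esub>"
    by (auto simp: heisenberg_group_def)
qed (auto simp: heisenberg_group_def heisenberg_matrix_mult matrix_mul_assoc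
       simp flip: heisenberg_matrix_one, blast+)

lemma heisenberg_subgroup_normal: "heisenberg_subgroup \<lhd> heisenberg_group"
proof -
  interpret group heisenberg_group by (rule group_heisenberg_group)
  have sub: "subgroup heisenberg_subgroup heisenberg_group"
  proof (rule subgroupI)
    show "heisenberg_subgroup \<subseteq> carrier heisenberg_group"
      by (auto simp: heisenberg_subgroup_def heisenberg_group_def)
    show "heisenberg_subgroup \<noteq> {}" using Ints_0 by (auto simp: heisenberg_subgroup_def)
  next
    fix A assume "A \<in> heisenberg_subgroup"
    then obtain c where c: "c \<in> \<int>" "A = heisenberg_matrix 0 0 c"
      by (auto simp: heisenberg_subgroup_def)
    have "inv\<^bsub>heisenberg_group\<^esub> A = heisenberg_matrix 0 0 (- c)"
      by (rule inv_equality)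
        (auto simp: heisenberg_group_def c heisenberg_matrix_mult heisenberg_matrix_one)
    then show "inv\<^bsub>heisenberg_group\<^esub> A \<in> heisenberg_subgroup"
      using c by (auto simp: heisenberg_subgroup_def)
  next
    fix A B assume "A \<in> heisenberg_subgroup" "B \<in> heisenberg_subgroup"
    then show "A \<otimes>\<^bsub>heisenberg_group\<^esub> B \<in> heisenberg_subgroup"
      by (auto simp: heisenberg_subgroup_def heisenberg_group_def heisenberg_matrix_mult)
  qed
  show ?thesis
    unfolding normal_inv_iff
  proof (intro conjI ballI sub)
    fix A B assume A: "A \<in> carrier heisenberg_group" and B: "B \<in> heisenberg_subgroup"
    have "A \<otimes>\<^bsub>heisenberg_group\<^esub> B = B \<otimes>\<^bsub>heisenberg_group\<^esub> A"
      using A B by (auto simp: heisenberg_subgroup_def heisenberg_group_def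
          heisenberg_matrix_mult add.commute)
    moreover have "B \<in> carrier heisenberg_group" using B sub subgroup.subset by blast
    ultimately have "A \<otimes>\<^bsub>heisenberg_group\<^esub> B \<otimes>\<^bsub>heisenberg_group\<^esub> inv\<^bsub>heisenberg_group\<^esub> A = B"
      using A by (simp add: m_assoc)
    then show "A \<otimes>\<^bsub>heisenberg_group\<^esub> B \<otimes>\<^bsub>heisenberg_group\<^esub> inv\<^bsub>heisenberg_group\<^esub> A
        \<in> heisenberg_subgroup" using B by simp
  qed
qed

subsection \<open>Isomorphism of Lie groups\<close>

text \<open>The smooth structure of a Lie group is determined by its underlying topological group:
  every continuous homomorphism between Lie groups is real analytic. Hence an isomorphism of Lie
  groups is a group isomorphism that is also a homeomorphism.\<close>

definition topological_group_iso ::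
    "('a, 'c) monoid_scheme \<Rightarrow> 'a topology \<Rightarrow> ('b, 'd) monoid_scheme \<Rightarrow> 'b topology \<Rightarrow> ('a \<Rightarrow> 'b) set"
  where
  "topological_group_iso G S H T = {\<phi> \<in> iso G H. homeomorphic_map S T \<phi>}"

end

(* The domain is D = {(p, q, z). z \<noteq> 0 and |z| exp (phi p q) < 1}, where phi is a convex function on C^2
   with quadratic growth that is, up to real parts of affine holomorphic functions, invariant under
   the real translations (p, q) \<mapsto> (p + w, q + cnj w) only. Lifting these translations to the z-coordinate
   produces the Heisenberg cocycle; multiplying z by (p, q, 1) makes D bounded.

   Let f be an automorphism. On each fibre, a punctured disc in z, the components of f extend over
   z = 0, and the last one vanishes there because f is proper. Being convex, phi is supported from
   below at every point by the real part of an affine holomorphic function, so the Schwarz lemma yields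
   rho (f x) \<le> rho x for rho = |z| exp (phi p q), and applying this to the inverse of f gives equality.
   The equality case of the Schwarz lemma forces f = (P, Q, z h) with P, Q, h depending on (p, q) only
   and ln |h| + phi (P, Q) = phi. By Borel-Caratheodory and Liouville, P and Q are affine. Finally
   phi fails to be differentiable exactly where q - cnj p is 0, 1 or \<i>, with kinks of different
   strength there; (P, Q) preserves the kinks and is therefore a translation by some (w, cnj w). *)

theory Submission
  imports Defs "HOL-Complex_Analysis.Complex_Analysis"
begin

no_notation fps_nth (infixl "$" 75)

subsection \<open>Scalar-valued holomorphic functions of several variables\<close>

text \<open>The puncture \<open>z \<noteq> 0\<close> is forced: the hyperplane \<open>z = 0\<close>
  would be a copy of C^2 inside the domain, on which every bounded holomorphic function is constant.
  The second base variable is there to break symmetry. In \<open>p\<close> alone the potential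
  \<open>pi / 2 * (norm p)^2\<close> already has the Heisenberg lifts, but it is also invariant
  under rotations of \<open>p\<close>. The variable \<open>q\<close> plays the role of
  \<open>cnj p\<close>: since \<open>q - cnj p\<close> is a complete invariant of the translations
  by \<open>(w, cnj w)\<close>, any function of it may be added to the potential without losing
  these symmetries, and \<open>chi\<close> is one with enough structure to exclude all others. The
  quadratic terms make the support from below strict, which is what forces constancy of
  \<open>P\<close> and \<open>Q\<close> along a fibre. Kinks are the right invariant for the final
  step because the unknown term \<open>ln (norm h)\<close> is differentiable along real lines, so it
  drops out when the kinks of both sides of the balance are compared.\<close>

definition holomorphic_fun_on :: "(complex ^ 'n \<Rightarrow> complex) \<Rightarrow> (complex ^ 'n) set \<Rightarrow> bool" where
  "holomorphic_fun_on f D \<longleftrightarrow>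
     (\<forall>x\<in>D. \<exists>L. (\<forall>c v. L (c *s v) = c * L v) \<and> (f has_derivative L) (at x within D))"

lemma has_derivative_vec_iff:
  fixes f :: "'a::real_normed_vector \<Rightarrow> complex ^ 'm"
  shows "(f has_derivative f') (at a within S) \<longleftrightarrow>
    (\<forall>i. ((\<lambda>x. f x $ i) has_derivative (\<lambda>x. f' x $ i)) (at a within S))"
proof
  assume "(f has_derivative f') (at a within S)"
  then show "\<forall>i. ((\<lambda>x. f x $ i) has_derivative (\<lambda>x. f' x $ i)) (at a within S)"
    using bounded_linear.has_derivative[OF bounded_linear_vec_nth] by blast
next
  assume R: "\<forall>i. ((\<lambda>x. f x $ i) has_derivative (\<lambda>x. f' x $ i)) (at a within S)"
  show "(f has_derivative f') (at a within S)"
  proof (subst has_derivative_componentwise_within, rule ballI)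
    fix e :: "complex ^ 'm" assume "e \<in> Basis"
    \<comment> \<open>A real basis vector lives in a single complex coordinate, so the inner product
      with it sees only that coordinate.\<close>
    then obtain i b where e: "e = axis i b" by (auto simp: Basis_vec_def)
    show "((\<lambda>x. f x \<bullet> e) has_derivative (\<lambda>x. f' x \<bullet> e)) (at a within S)"
      unfolding e inner_axis using R by (auto intro: has_derivative_inner_left)
  qed
qed

lemma holomorphic_map_on_iff:
  "holomorphic_map_on f D \<longleftrightarrow> (\<forall>i. holomorphic_fun_on (\<lambda>x. f x $ i) D)"
proof
  assume f: "holomorphic_map_on f D"
  show "\<forall>i. holomorphic_fun_on (\<lambda>x. f x $ i) D"
    unfolding holomorphic_fun_on_def
  proof (intro allI ballI)
    fix i x assume "x \<in> D"
    then obtain L where L: "Vector_Spaces.linear (*s) (*s) L" "(f has_derivative L) (at x within D)"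
      using f unfolding holomorphic_map_on_def by blast
    have "L (c *s v) $ i = c * L v $ i" for c v
      using L(1) by (simp add: vec.linear_scale)
    then show "\<exists>L. (\<forall>c v. L (c *s v) = c * L v) \<and>
        ((\<lambda>x. f x $ i) has_derivative L) (at x within D)"
      using L(2) unfolding has_derivative_vec_iff by (intro exI[of _ "\<lambda>v. L v $ i"]) auto
  qed
next
  assume R: "\<forall>i. holomorphic_fun_on (\<lambda>x. f x $ i) D"
  show "holomorphic_map_on f D"
    unfolding holomorphic_map_on_def
  proof
    fix x assume "x \<in> D"
    then have "\<forall>i. \<exists>L. (\<forall>c v. L (c *s v) = c * L v) \<and>
        ((\<lambda>x. f x $ i) has_derivative L) (at x within D)"
      using R by (simp add: holomorphic_fun_on_def)
    from choice[OF this] obtain L where L: "\<And>i c v. L i (c *s v) = c * L i v"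
        "\<And>i. ((\<lambda>x. f x $ i) has_derivative L i) (at x within D)"
      by blast
    \<comment> \<open>\<open>holomorphic_fun_on\<close> asks \<open>L\<close> only for complex
      homogeneity; additivity comes with \<open>has_derivative\<close>.\<close>
    have add: "L i (u + v) = L i u + L i v" for i u v
      by (rule linear_add[OF bounded_linear.linear[OF has_derivative_bounded_linear[OF L(2)]]])
    have "Vector_Spaces.linear (*s) (*s) (\<lambda>v. \<chi> i. L i v)"
      by unfold_locales (auto simp: vec_eq_iff add L(1) algebra_simps)
    moreover have "(f has_derivative (\<lambda>v. \<chi> i. L i v)) (at x within D)"
      unfolding has_derivative_vec_iff using L(2) by simp
    ultimately show "\<exists>L. Vector_Spaces.linear (*s) (*s) L \<and> (f has_derivative L) (at x within D)"
      by blast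
  qed
qed

lemma holomorphic_fun_on_const: "holomorphic_fun_on (\<lambda>x. c) D"
  unfolding holomorphic_fun_on_def by (auto intro!: exI[of _ "\<lambda>v. 0"])

lemma holomorphic_fun_on_nth: "holomorphic_fun_on (\<lambda>x. x $ i) D"
  unfolding holomorphic_fun_on_def
  by (auto intro!: exI[of _ "\<lambda>v. v $ i"] bounded_linear_imp_has_derivative bounded_linear_vec_nth)

lemma holomorphic_fun_on_add:
  assumes "holomorphic_fun_on f D" "holomorphic_fun_on g D"
  shows "holomorphic_fun_on (\<lambda>x. f x + g x) D"
  unfolding holomorphic_fun_on_def
proof
  fix x assume x: "x \<in> D"
  obtain L M where L: "\<forall>c v. L (c *s v) = c * L v" "(f has_derivative L) (at x within D)"
    and M: "\<forall>c v. M (c *s v) = c * M v" "(g has_derivative M) (at x within D)"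
    using assms x unfolding holomorphic_fun_on_def by blast
  show "\<exists>N. (\<forall>c v. N (c *s v) = c * N v) \<and> ((\<lambda>x. f x + g x) has_derivative N) (at x within D)"
    using L(1) M(1) has_derivative_add[OF L(2) M(2)]
    by (intro exI[of _ "\<lambda>v. L v + M v"]) (simp add: distrib_left)
qed

lemma holomorphic_fun_on_mult:
  assumes "holomorphic_fun_on f D" "holomorphic_fun_on g D"
  shows "holomorphic_fun_on (\<lambda>x. f x * g x) D"
  unfolding holomorphic_fun_on_def
proof
  fix x assume x: "x \<in> D"
  obtain L M where L: "\<forall>c v. L (c *s v) = c * L v" "(f has_derivative L) (at x within D)"
    and M: "\<forall>c v. M (c *s v) = c * M v" "(g has_derivative M) (at x within D)"
    using assms x unfolding holomorphic_fun_on_def by blast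
  show "\<exists>N. (\<forall>c v. N (c *s v) = c * N v) \<and> ((\<lambda>x. f x * g x) has_derivative N) (at x within D)"
    using L(1) M(1) has_derivative_mult[OF L(2) M(2)]
    by (intro exI[of _ "\<lambda>v. f x * M v + L v * g x"]) (simp add: algebra_simps)
qed

lemma holomorphic_fun_on_compose:
  assumes "holomorphic_fun_on f D" "g holomorphic_on T" "open T" "f ` D \<subseteq> T"
  shows "holomorphic_fun_on (\<lambda>x. g (f x)) D"
  unfolding holomorphic_fun_on_def
proof
  fix x assume x: "x \<in> D"
  obtain L where L: "\<forall>c v. L (c *s v) = c * L v" "(f has_derivative L) (at x within D)"
    using assms x unfolding holomorphic_fun_on_def by blast
  have "(g has_field_derivative deriv g (f x)) (at (f x))"
    using assms x by (intro holomorphic_derivI[of g T]) auto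
  then have "((\<lambda>x. g (f x)) has_derivative (\<lambda>v. deriv g (f x) * L v)) (at x within D)"
    using has_derivative_compose[OF L(2)] by (simp add: has_field_derivative_def)
  then show "\<exists>N. (\<forall>c v. N (c *s v) = c * N v) \<and> ((\<lambda>x. g (f x)) has_derivative N) (at x within D)"
    using L(1) by (intro exI[of _ "\<lambda>v. deriv g (f x) * L v"]) simp
qed

lemma holomorphic_fun_on_inverse:
  assumes "holomorphic_fun_on f D" "\<And>x. x \<in> D \<Longrightarrow> f x \<noteq> 0"
  shows "holomorphic_fun_on (\<lambda>x. inverse (f x)) D"
  by (rule holomorphic_fun_on_compose[OF assms(1), where T = "- {0}"])
    (use assms(2) in \<open>auto intro!: holomorphic_intros\<close>)

lemma holomorphic_map_on_vector3:
  assumes "holomorphic_fun_on f D" "holomorphic_fun_on g D" "holomorphic_fun_on h D"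
  shows "holomorphic_map_on (\<lambda>x. vector [f x, g x, h x] :: complex ^ 3) D"
  unfolding holomorphic_map_on_iff forall_3 using assms by simp

lemma holomorphic_map_on_imp_continuous_on: "holomorphic_map_on f D \<Longrightarrow> continuous_on D f"
  unfolding holomorphic_map_on_def continuous_on_eq_continuous_within
  by (blast intro: has_derivative_continuous)

text \<open>The bridge to one-variable theory: in the analysis of an automorphism, holomorphy in
  several variables enters through restriction to complex lines and through continuity of the
  inverse map.\<close>

lemma holomorphic_map_on_line:
  assumes f: "holomorphic_map_on f D" and "open D"
  shows "(\<lambda>\<zeta>. f (a + \<zeta> *s b) $ i) holomorphic_on {\<zeta>. a + \<zeta> *s b \<in> D}"
  unfolding holomorphic_on_def
proof
  fix \<zeta> assume "\<zeta> \<in> {\<zeta>. a + \<zeta> *s b \<in> D}"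
  then have D: "a + \<zeta> *s b \<in> D" by simp
  have "holomorphic_fun_on (\<lambda>x. f x $ i) D" using f holomorphic_map_on_iff by blast
  from bspec[OF this[unfolded holomorphic_fun_on_def] D]
  obtain L where "(\<forall>c v. L (c *s v) = c * L v) \<and>
      ((\<lambda>x. f x $ i) has_derivative L) (at (a + \<zeta> *s b) within D)" ..
  note L = this[THEN conjunct1] this[THEN conjunct2]
  have d: "((\<lambda>\<zeta>. a + \<zeta> *s b) has_derivative (\<lambda>\<zeta>. \<zeta> *s b)) (at \<zeta>)"
    unfolding has_derivative_vec_iff by (auto intro!: derivative_eq_intros)
  have "((\<lambda>x. f x $ i) has_derivative L) (at (a + \<zeta> *s b))"
    using L(2) unfolding at_within_open[OF D \<open>open D\<close>] .
  then have "((\<lambda>\<zeta>. f (a + \<zeta> *s b) $ i) has_derivative (\<lambda>\<zeta>. L (\<zeta> *s b))) (at \<zeta>)"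
    by (rule has_derivative_compose[OF d])
  then have "((\<lambda>\<zeta>. f (a + \<zeta> *s b) $ i) has_field_derivative L b) (at \<zeta>)"
    unfolding has_field_derivative_def L(1)[rule_format] mult_commute_abs .
  then show "(\<lambda>\<zeta>. f (a + \<zeta> *s b) $ i) field_differentiable at \<zeta> within {\<zeta>. a + \<zeta> *s b \<in> D}"
    using field_differentiable_at_within field_differentiable_def by blast
qed

subsection \<open>The potential and removable singularities on fibres\<close>

text \<open>The three cone points 0, 1, \<open>\<i>\<close> are not collinear and carry distinct weights, so that no
  nontrivial real affine map of the plane respects them.\<close>

definition chi :: "complex \<Rightarrow> real" where
  "chi w = (norm w)\<^sup>2 + norm w + 2 * norm (w - 1) + 4 * norm (w - \<i>)"

text \<open>Translation by \<open>(w, cnj w)\<close> adds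
  \<open>Re (pi * cnj w * p + pi / 2 * (norm w)^2)\<close>, the real part of an affine holomorphic
  function. The factor \<open>pi / 2\<close> is tuned so that the lifts for
  \<open>w = a - \<i> * b\<close> and \<open>w' = a' - \<i> * b'\<close> commute up to
  \<open>exp (2 * pi * \<i> * (a * b' - a' * b))\<close>, which gives the centre period 1 in
  \<open>c\<close>.\<close>

definition phi :: "complex \<Rightarrow> complex \<Rightarrow> real" where
  "phi p q = pi / 2 * (norm p)\<^sup>2 + chi (q - cnj p)"

text \<open>\<open>sgn (w0 - b)\<close> is a subgradient of the norm. At the cone point
  \<open>w0 = b\<close> it is 0, which is still a subgradient there.\<close>

lemma norm_support:
  fixes b w w0 :: complex
  shows "norm (w0 - b) + Re (cnj (sgn (w0 - b)) * (w - w0)) \<le> norm (w - b)"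
proof -
  let ?s = "sgn (w0 - b)"
  have "norm (w0 - b) = Re (cnj ?s * (w0 - b))"
  proof -
    have "cnj (sgn x) * x = of_real (norm x)" for x :: complex
    proof -
      have "cnj (sgn x) * x = (x * cnj x) / of_real (norm x)"
        by (simp add: sgn_eq)
      then show ?thesis by (simp add: power2_eq_square flip: complex_norm_square)
    qed
    then show ?thesis by simp
  qed
  then have "norm (w0 - b) + Re (cnj ?s * (w - w0)) = Re (cnj ?s * (w - b))"
    by (simp add: algebra_simps)
  also have "\<dots> \<le> norm (cnj ?s * (w - b))" by (rule complex_Re_le_cmod)
  also have "\<dots> \<le> norm (w - b)"
    by (simp add: norm_mult norm_sgn)
  finally show ?thesis .
qed

lemma norm_power2_expand:
  fixes w w0 :: complex
  shows "(norm w)\<^sup>2 = (norm w0)\<^sup>2 + Re (2 * cnj w0 * (w - w0)) + (norm (w - w0))\<^sup>2"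
  unfolding cmod_power2 by (simp add: power2_eq_square algebra_simps)

text \<open>Subgradients of the summands are added up. The squares that remain come from the two
  quadratic terms; they turn equality in the Schwarz lemma into constancy of the base
  components.\<close>

lemma phi_support:
  obtains \<alpha> \<beta> where "\<And>p q. phi p0 q0 + Re (\<alpha> * (p - p0) + \<beta> * (q - q0))
      + (norm (p - p0))\<^sup>2 + (norm ((q - cnj p) - (q0 - cnj p0)))\<^sup>2 \<le> phi p q"
proof -
  define w0 where "w0 = q0 - cnj p0"
  define s where "s = 2 * cnj w0 + cnj (sgn w0) + 2 * cnj (sgn (w0 - 1)) + 4 * cnj (sgn (w0 - \<i>))"
  have chi: "chi w0 + Re (s * (w - w0)) + (norm (w - w0))\<^sup>2 \<le> chi w" for w
  proof -
    have "Re (s * (w - w0)) = Re (2 * cnj w0 * (w - w0)) + Re (cnj (sgn (w0 - 0)) * (w - w0))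
        + 2 * Re (cnj (sgn (w0 - 1)) * (w - w0)) + 4 * Re (cnj (sgn (w0 - \<i>)) * (w - w0))"
      by (simp add: s_def algebra_simps)
    then show ?thesis
      using norm_support[of w0 0 w] norm_support[of w0 1 w] norm_support[of w0 \<i> w]
        norm_power2_expand[of w w0] unfolding chi_def by simp
  qed
  have "phi p0 q0 + Re ((pi * cnj p0 - cnj s) * (p - p0) + s * (q - q0))
      + (norm (p - p0))\<^sup>2 + (norm ((q - cnj p) - (q0 - cnj p0)))\<^sup>2 \<le> phi p q" for p q
  proof -
    \<comment> \<open>Since \<open>Re (s * cnj x) = Re (cnj s * x)\<close>, the antiholomorphic
      \<open>cnj p\<close> can be traded for \<open>p\<close>, so the supporting functional is the
      real part of a holomorphic one.\<close>
    have 1: "Re ((pi * cnj p0 - cnj s) * (p - p0) + s * (q - q0))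
        = pi / 2 * Re (2 * cnj p0 * (p - p0)) + Re (s * ((q - cnj p) - w0))"
      by (simp add: w0_def algebra_simps)
    have "1 * (norm (p - p0))\<^sup>2 \<le> pi / 2 * (norm (p - p0))\<^sup>2"
      using pi_gt3 by (intro mult_right_mono) auto
    moreover have "pi / 2 * (norm p)\<^sup>2 = pi / 2 * (norm p0)\<^sup>2 + pi / 2 * Re (2 * cnj p0 * (p - p0))
        + pi / 2 * (norm (p - p0))\<^sup>2"
      by (subst norm_power2_expand[of p p0]) (simp only: distrib_left)
    ultimately show ?thesis
      using chi[of "q - cnj p"] unfolding 1 phi_def w0_def[symmetric] by argo
  qed
  then show thesis by (rule that)
qed

lemma phi_nonneg: "0 \<le> phi p q"
  by (simp add: phi_def chi_def)

text \<open>Together with the analogous bound for \<open>q\<close>, this lets any bound on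
  \<open>phi\<close> control both base coordinates: at the puncture of a fibre, at infinity, and for
  boundedness.\<close>

lemma phi_ge_norm_p: "(norm p)\<^sup>2 \<le> phi p q"
proof -
  have "1 * (norm p)\<^sup>2 \<le> pi / 2 * (norm p)\<^sup>2"
    using pi_gt3 by (intro mult_right_mono) auto
  moreover have "0 \<le> chi (q - cnj p)" by (simp add: chi_def)
  ultimately show ?thesis by (simp add: phi_def)
qed

lemma phi_ge_norm_q: "(norm q)\<^sup>2 \<le> 2 * phi p q"
proof -
  have "1 * (norm p)\<^sup>2 \<le> pi / 2 * (norm p)\<^sup>2"
    using pi_gt3 by (intro mult_right_mono) auto
  moreover have "(norm (q - cnj p))\<^sup>2 \<le> chi (q - cnj p)" by (simp add: chi_def)
  moreover have "norm q \<le> norm (q - cnj p) + norm p"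
    by (metis complex_mod_cnj norm_triangle_sub add.commute)
  then have "(norm q)\<^sup>2 \<le> (norm (q - cnj p) + norm p)\<^sup>2" by (intro power_mono) auto
  moreover have "(norm (q - cnj p) + norm p)\<^sup>2 \<le> 2 * (norm (q - cnj p))\<^sup>2 + 2 * (norm p)\<^sup>2"
    using zero_le_power2[of "norm (q - cnj p) - norm p"] by (simp add: power2_eq_square algebra_simps)
  ultimately show ?thesis unfolding phi_def by argo
qed

text \<open>With \<open>w = q - cnj p\<close>, the cone terms add up to at most
  \<open>7 * norm w + 6\<close>; absorbing them into squares leaves coefficients below 12. Only the
  quadratic order matters: it is what makes the base map affine.\<close>

lemma phi_le: "phi p q \<le> 12 * (1 + (norm p)\<^sup>2 + (norm q)\<^sup>2)"
proof -
  let ?w = "q - cnj p"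
  have "norm ?w \<le> norm q + norm p" using norm_triangle_ineq4[of q "cnj p"] by simp
  then have "(norm ?w)\<^sup>2 \<le> (norm q + norm p)\<^sup>2" by (intro power_mono) auto
  moreover have "(norm q + norm p)\<^sup>2 \<le> 2 * (norm q)\<^sup>2 + 2 * (norm p)\<^sup>2"
    using zero_le_power2[of "norm q - norm p"] by (simp add: power2_eq_square algebra_simps)
  moreover have "2 * norm ?w \<le> 1 + (norm ?w)\<^sup>2"
    using zero_le_power2[of "norm ?w - 1"] by (simp add: power2_eq_square algebra_simps)
  moreover have "norm (?w - 1) \<le> norm ?w + 1" using norm_triangle_ineq4[of ?w 1] by simp
  moreover have "norm (?w - \<i>) \<le> norm ?w + 1" using norm_triangle_ineq4[of ?w \<i>] by simp
  moreover have "pi / 2 * (norm p)\<^sup>2 \<le> 2 * (norm p)\<^sup>2"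
    using pi_less_4 by (intro mult_right_mono) auto
  ultimately show ?thesis unfolding phi_def chi_def
    using zero_le_power2[of "norm p"] zero_le_power2[of "norm q"] by argo
qed

lemma continuous_on_phi [continuous_intros]:
  "continuous_on S f \<Longrightarrow> continuous_on S g \<Longrightarrow> continuous_on S (\<lambda>x. phi (f x) (g x))"
  unfolding phi_def chi_def by (intro continuous_intros)

section \<open>Removable singularities under logarithmic growth\<close>

text \<open>A zero of \<open>F\<close> at 0 is isolated, hence of finite order \<open>n\<close>. If
  \<open>F 0 \<noteq> 0\<close>, continuity gives the bound with \<open>n = 0\<close>.\<close>

lemma isolated_zero_lower_bound:
  assumes "0 < R" "F holomorphic_on ball 0 R" "\<And>z. z \<in> ball 0 R - {0} \<Longrightarrow> F z \<noteq> 0"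
  obtains k r n where "0 < k" "0 < r" "r \<le> R" "\<And>z. z \<in> ball 0 r \<Longrightarrow> k * norm z ^ n \<le> norm (F z)"
proof (cases "F 0 = 0")
  case True
  have "of_real (R / 2) \<in> ball 0 R - {0::complex}" using \<open>0 < R\<close> by simp
  then obtain k n r where "0 < k" "0 < r" "ball (0::complex) r \<subseteq> ball 0 R"
      "\<And>w. w \<in> ball 0 r \<Longrightarrow> k * norm (w - 0) ^ n \<le> norm (F w - F 0)"
    using holomorphic_lower_bound_difference[OF assms(2), of 0 "of_real (R / 2)"] assms(1,3) True
    by (metis DiffD1 centre_in_ball connected_ball open_ball)
  then show thesis using that[of k r n] True \<open>0 < R\<close> by (simp add: ball_subset_ball_iff)
next
  case False
  have "continuous (at 0) F"
    using assms(1,2) by (meson centre_in_ball continuous_on_eq_continuous_at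
        holomorphic_on_imp_continuous_on open_ball)
  then obtain d where d: "0 < d" "\<And>z. dist z 0 < d \<Longrightarrow> dist (F z) (F 0) < norm (F 0) / 2"
    using False unfolding continuous_at_eps_delta
    by (metis zero_less_norm_iff half_gt_zero)
  have "norm (F 0) / 2 * norm z ^ 0 \<le> norm (F z)" if "z \<in> ball 0 (min d R)" for z
  proof -
    have "norm (F z - F 0) < norm (F 0) / 2" using d(2)[of z] that by (simp add: dist_norm)
    then show ?thesis using norm_triangle_ineq2[of "F 0" "F z"] by (simp add: norm_minus_commute)
  qed
  then show thesis using that[of "norm (F 0) / 2" "min d R" 0] False \<open>0 < R\<close> d(1) by auto
qed

text \<open>As \<open>F\<close> vanishes at 0 to finite order at most, \<open>f\<close> grows no
  faster than the root of a logarithm. Although \<open>f\<close> is not known to be bounded,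
  \<open>z * f z\<close> tends to 0, which suffices for Riemann's theorem.\<close>

lemma log_growth_removable:
  assumes "0 < R" and F: "F holomorphic_on ball 0 R" "\<And>z. z \<in> ball 0 R - {0} \<Longrightarrow> F z \<noteq> 0"
    and f: "f holomorphic_on ball 0 R - {0}"
      "\<And>z. z \<in> ball 0 R - {0} \<Longrightarrow> (norm (f z))\<^sup>2 \<le> - 2 * ln (norm (F z))"
  obtains g where "g holomorphic_on ball 0 R" "\<And>z. z \<in> ball 0 R - {0} \<Longrightarrow> g z = f z"
proof -
  obtain k r n where k: "0 < k" "0 < r" "r \<le> R"
    "\<And>z. z \<in> ball 0 r \<Longrightarrow> k * norm z ^ n \<le> norm (F z)"
    using isolated_zero_lower_bound[OF \<open>0 < R\<close> F] by metis
  let ?b = "\<lambda>z::complex. sqrt (2 * \<bar>ln k\<bar> * (norm z)\<^sup>2 + 2 * n * norm z)"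
  have bound: "norm ((z - 0) * f z) \<le> ?b z" if z: "z \<in> ball 0 r - {0}" for z
  proof -
    have nz: "0 < norm z" using z by simp
    have "ln (k * norm z ^ n) \<le> ln (norm (F z))"
      using k z nz by (intro ln_mono) auto
    then have "- ln (norm (F z)) \<le> - ln k - n * ln (norm z)"
      using nz k(1) by (simp add: ln_mult ln_realpow)
    also have "\<dots> \<le> \<bar>ln k\<bar> + n * (1 / norm z)"
    proof -
      \<comment> \<open>This crude bound is enough: multiplied by \<open>(norm z)^2\<close>, the
        term \<open>1 / norm z\<close> still tends to 0.\<close>
      have "- ln (norm z) \<le> 1 / norm z"
        using ln_le_minus_one[of "1 / norm z"] nz by (simp add: ln_div)
      then have "n * (- ln (norm z)) \<le> n * (1 / norm z)" by (intro mult_left_mono) auto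
      then show ?thesis by simp
    qed
    finally have ln: "- ln (norm (F z)) \<le> \<bar>ln k\<bar> + n * (1 / norm z)" .
    have "(norm (z * f z))\<^sup>2 = (norm z)\<^sup>2 * (norm (f z))\<^sup>2" by (simp add: norm_mult power_mult_distrib)
    also have "\<dots> \<le> (norm z)\<^sup>2 * (2 * (\<bar>ln k\<bar> + n * (1 / norm z)))"
      using f(2)[of z] ln z k(3) by (intro mult_left_mono) auto
    also have "\<dots> = 2 * \<bar>ln k\<bar> * (norm z)\<^sup>2 + 2 * n * norm z"
      using nz by (simp add: field_simps power2_eq_square)
    finally show ?thesis by (simp add: real_le_rsqrt)
  qed
  have "(?b \<longlongrightarrow> ?b 0) (at 0)" by (intro tendsto_intros)
  then have "(?b \<longlongrightarrow> 0) (at 0)" by simp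
  then have "((\<lambda>z. (z - 0) * f z) \<longlongrightarrow> 0) (at 0)"
  proof (rule Lim_null_comparison[rotated])
    show "\<forall>\<^sub>F z in at 0. norm ((z - 0) * f z) \<le> ?b z"
      unfolding eventually_at by (rule exI[of _ r]) (use bound k(2) in auto)
  qed
  then show thesis
    using holomorphic_on_extend_lim[OF f(1)] \<open>0 < R\<close> that by auto
qed

text \<open>The last component is bounded because \<open>phi\<close> is nonnegative. Once it is
  extended, its finite order of vanishing limits the growth of the other two through
  \<open>phi \<le> - ln (norm f3)\<close>.\<close>

lemma fibre_extension:
  assumes "0 < R"
    and hol: "f1 holomorphic_on ball 0 R - {0}" "f2 holomorphic_on ball 0 R - {0}"
      "f3 holomorphic_on ball 0 R - {0}"
    and nz: "\<And>z. z \<in> ball 0 R - {0} \<Longrightarrow> f3 z \<noteq> 0"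
    and lt: "\<And>z. z \<in> ball 0 R - {0} \<Longrightarrow> norm (f3 z) * exp (phi (f1 z) (f2 z)) < 1"
  obtains F1 F2 F3 where "F1 holomorphic_on ball 0 R" "F2 holomorphic_on ball 0 R"
    "F3 holomorphic_on ball 0 R"
    "\<And>z. z \<in> ball 0 R - {0} \<Longrightarrow> F1 z = f1 z \<and> F2 z = f2 z \<and> F3 z = f3 z"
proof -
  have ln: "phi (f1 z) (f2 z) \<le> - ln (norm (f3 z))" if "z \<in> ball 0 R - {0}" for z
  proof -
    have "ln (norm (f3 z) * exp (phi (f1 z) (f2 z))) < 0"
      using lt[OF that] nz[OF that] by (simp add: ln_less_zero)
    then show ?thesis using nz[OF that] by (simp add: ln_mult)
  qed
  have lt1: "norm (f3 z) < 1" if "z \<in> ball 0 R - {0}" for z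
  proof -
    have "norm (f3 z) * 1 \<le> norm (f3 z) * exp (phi (f1 z) (f2 z))"
      using phi_nonneg by (intro mult_left_mono) auto
    then show ?thesis using lt[OF that] by simp
  qed
  have "\<forall>\<^sub>F z in at 0. norm (f3 z) \<le> 1"
    unfolding eventually_at by (rule exI[of _ R]) (use lt1 \<open>0 < R\<close> less_imp_le in auto)
  then obtain F3 where F3: "F3 holomorphic_on ball 0 R" "\<And>z. z \<in> ball 0 R - {0} \<Longrightarrow> F3 z = f3 z"
    using holomorphic_on_extend_bounded[OF hol(3)] \<open>0 < R\<close> by auto
  have F3nz: "\<And>z. z \<in> ball 0 R - {0} \<Longrightarrow> F3 z \<noteq> 0" using F3(2) nz by metis
  have b1: "(norm (f1 z))\<^sup>2 \<le> - 2 * ln (norm (F3 z))" if "z \<in> ball 0 R - {0}" for z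
    using ln[OF that] phi_ge_norm_p[of "f1 z" "f2 z"] phi_nonneg[of "f1 z" "f2 z"] F3(2)[OF that]
    by (simp add: mult.commute)
  have b2: "(norm (f2 z))\<^sup>2 \<le> - 2 * ln (norm (F3 z))" if "z \<in> ball 0 R - {0}" for z
    using ln[OF that] phi_ge_norm_q[of "f2 z" "f1 z"] F3(2)[OF that] by simp
  obtain F1 where "F1 holomorphic_on ball 0 R" "\<And>z. z \<in> ball 0 R - {0} \<Longrightarrow> F1 z = f1 z"
    using log_growth_removable[OF \<open>0 < R\<close> F3(1) F3nz hol(1) b1] by metis
  moreover obtain F2 where "F2 holomorphic_on ball 0 R" "\<And>z. z \<in> ball 0 R - {0} \<Longrightarrow> F2 z = f2 z"
    using log_growth_removable[OF \<open>0 < R\<close> F3(1) F3nz hol(2) b2] by metis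
  ultimately show thesis using that F3 by blast
qed

subsection \<open>One-variable estimates\<close>

text \<open>A holomorphic minorant of the plurisubharmonic function \<open>norm (F3 z) * exp (phi (F1 z) (F2 z))\<close>
  that touches it at \<open>z0\<close>.\<close>

lemma peak_function:
  assumes hol: "F1 holomorphic_on S" "F2 holomorphic_on S" "F3 holomorphic_on S"
  obtains E where "(\<lambda>z. F3 z * exp (E z)) holomorphic_on S"
    "E z0 = phi (F1 z0) (F2 z0)"
    "\<And>z. F1 z = F1 z0 \<Longrightarrow> F2 z = F2 z0 \<Longrightarrow> E z = E z0"
    "\<And>z. norm (F3 z * exp (E z)) * exp ((norm (F1 z - F1 z0))\<^sup>2
        + (norm ((F2 z - cnj (F1 z)) - (F2 z0 - cnj (F1 z0))))\<^sup>2)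
      \<le> norm (F3 z) * exp (phi (F1 z) (F2 z))"
    "\<And>z. norm (F3 z * exp (E z)) \<le> norm (F3 z) * exp (phi (F1 z) (F2 z))"
proof -
  obtain \<alpha> \<beta> where supp: "\<And>p q. phi (F1 z0) (F2 z0) + Re (\<alpha> * (p - F1 z0) + \<beta> * (q - F2 z0))
      + (norm (p - F1 z0))\<^sup>2 + (norm ((q - cnj p) - (F2 z0 - cnj (F1 z0))))\<^sup>2 \<le> phi p q"
    using phi_support by blast
  define E where "E = (\<lambda>z. of_real (phi (F1 z0) (F2 z0))
      + (\<alpha> * (F1 z - F1 z0) + \<beta> * (F2 z - F2 z0)))"
  \<comment> \<open>The quadratic surplus of the support inequality is kept as a separate factor, to
    detect variation of \<open>F1\<close> and \<open>F2\<close>.\<close>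
  have gain: "norm (F3 z * exp (E z)) * exp ((norm (F1 z - F1 z0))\<^sup>2
        + (norm ((F2 z - cnj (F1 z)) - (F2 z0 - cnj (F1 z0))))\<^sup>2)
      \<le> norm (F3 z) * exp (phi (F1 z) (F2 z))" for z
  proof -
    have "norm (F3 z * exp (E z)) * exp ((norm (F1 z - F1 z0))\<^sup>2
        + (norm ((F2 z - cnj (F1 z)) - (F2 z0 - cnj (F1 z0))))\<^sup>2)
      = norm (F3 z) * exp (Re (E z) + (norm (F1 z - F1 z0))\<^sup>2
        + (norm ((F2 z - cnj (F1 z)) - (F2 z0 - cnj (F1 z0))))\<^sup>2)"
      by (simp add: norm_mult exp_add)
    also have "\<dots> \<le> norm (F3 z) * exp (phi (F1 z) (F2 z))"
      using supp[of "F1 z" "F2 z"] by (intro mult_left_mono) (auto simp: E_def)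
    finally show ?thesis .
  qed
  show thesis
  proof (rule that[of E])
    show "(\<lambda>z. F3 z * exp (E z)) holomorphic_on S"
      unfolding E_def by (intro holomorphic_intros hol)
    show "norm (F3 z * exp (E z)) \<le> norm (F3 z) * exp (phi (F1 z) (F2 z))" for z
    proof -
      have "norm (F3 z * exp (E z)) * 1 \<le> norm (F3 z * exp (E z)) * exp ((norm (F1 z - F1 z0))\<^sup>2
        + (norm ((F2 z - cnj (F1 z)) - (F2 z0 - cnj (F1 z0))))\<^sup>2)"
        by (intro mult_left_mono) auto
      then show ?thesis using gain[of z] by linarith
    qed
  qed (use gain in \<open>auto simp: E_def\<close>)
qed

text \<open>Otherwise the peak function touching at 0 would have an interior maximum of its modulus
  there, hence be constant, while its modulus is below 1 off 0. So the limit at the puncture never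
  lies on the part of the boundary where the product equals 1.\<close>

lemma fibre_limit_interior:
  assumes "0 < R"
    and hol: "F1 holomorphic_on ball 0 R" "F2 holomorphic_on ball 0 R" "F3 holomorphic_on ball 0 R"
    and lt: "\<And>z. z \<in> ball 0 R - {0} \<Longrightarrow> norm (F3 z) * exp (phi (F1 z) (F2 z)) < 1"
  shows "norm (F3 0) * exp (phi (F1 0) (F2 0)) < 1"
proof (rule ccontr)
  assume ge: "\<not> norm (F3 0) * exp (phi (F1 0) (F2 0)) < 1"
  obtain E where E: "(\<lambda>z. F3 z * exp (E z)) holomorphic_on ball 0 R"
    "E 0 = phi (F1 0) (F2 0)"
    "\<And>z. norm (F3 z * exp (E z)) \<le> norm (F3 z) * exp (phi (F1 z) (F2 z))"
    by (rule peak_function[OF hol, of 0]) blast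
  let ?v = "\<lambda>z. F3 z * exp (E z)"
  have v0: "1 \<le> norm (?v 0)" using ge by (simp add: E(2) norm_mult)
  have v: "norm (?v z) < 1" if "z \<in> ball 0 R - {0}" for z
    using lt[OF that] E(3)[of z] by linarith
  have "?v constant_on ball 0 R"
  proof (rule maximum_modulus_principle[OF E(1), of "ball 0 R" 0])
    fix z :: complex assume "z \<in> ball 0 R"
    then show "norm (?v z) \<le> norm (?v 0)" using v[of z] v0 by (cases "z = 0") auto
  qed (use \<open>0 < R\<close> in auto)
  moreover have "of_real (R / 2) \<in> ball 0 R - {0::complex}" using \<open>0 < R\<close> by simp
  ultimately have "?v (of_real (R / 2)) = ?v 0" "norm (?v (of_real (R / 2))) < 1"
    using v \<open>0 < R\<close> unfolding constant_on_def by (metis DiffD1 centre_in_ball, blast)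
  then show False using v0 by simp
qed

text \<open>Because \<open>F3 0 = 0\<close>, the peak function touching at \<open>z0\<close>
  vanishes at 0, and the Schwarz lemma on the rescaled disc applies to it.\<close>

lemma fibre_schwarz:
  assumes "0 < R"
    and hol: "F1 holomorphic_on ball 0 R" "F2 holomorphic_on ball 0 R" "F3 holomorphic_on ball 0 R"
    and lt: "\<And>z. z \<in> ball 0 R - {0} \<Longrightarrow> norm (F3 z) * exp (phi (F1 z) (F2 z)) < 1"
    and F30: "F3 0 = 0" and z0: "z0 \<in> ball 0 R - {0}"
  shows "norm (F3 z0) * exp (phi (F1 z0) (F2 z0)) \<le> norm z0 / R"
    and "(\<And>z. z \<in> ball 0 R - {0} \<Longrightarrow> norm (F3 z) * exp (phi (F1 z) (F2 z)) = norm z / R)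
      \<Longrightarrow> \<exists>a. \<forall>z\<in>ball 0 R - {0}. F1 z = F1 z0 \<and> F2 z = F2 z0 \<and> F3 z = z * a"
proof -
  obtain E where E: "(\<lambda>z. F3 z * exp (E z)) holomorphic_on ball 0 R"
    "E z0 = phi (F1 z0) (F2 z0)"
    "\<And>z. F1 z = F1 z0 \<Longrightarrow> F2 z = F2 z0 \<Longrightarrow> E z = E z0"
    "\<And>z. norm (F3 z * exp (E z)) * exp ((norm (F1 z - F1 z0))\<^sup>2
        + (norm ((F2 z - cnj (F1 z)) - (F2 z0 - cnj (F1 z0))))\<^sup>2)
      \<le> norm (F3 z) * exp (phi (F1 z) (F2 z))"
    "\<And>z. norm (F3 z * exp (E z)) \<le> norm (F3 z) * exp (phi (F1 z) (F2 z))"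
    by (rule peak_function[OF hol, of z0]) blast
  define v where "v = (\<lambda>z. F3 z * exp (E z))"
  define u where "u = (\<lambda>z. v (of_real R * z))"
  have vz0: "norm (v z0) = norm (F3 z0) * exp (phi (F1 z0) (F2 z0))"
    by (simp add: v_def E(2) norm_mult)
  have inball: "R * z \<in> ball 0 R" if "norm z < 1" for z :: complex
    using that \<open>0 < R\<close> by (simp add: norm_mult)
  have "u holomorphic_on ball 0 1"
    unfolding u_def using inball E(1)[folded v_def]
    by (intro holomorphic_on_compose_gen[of "\<lambda>z. R * z" _ v, unfolded o_def]) (auto intro!: holomorphic_intros)
  moreover have "u 0 = 0" by (simp add: u_def v_def F30)
  moreover have "norm (u z) < 1" if "norm z < 1" for z
  proof (cases "z = 0")
    case True
    then show ?thesis using \<open>u 0 = 0\<close> by simp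
  next
    case False
    then have "R * z \<in> ball 0 R - {0}" using inball[OF that] \<open>0 < R\<close> by simp
    then show ?thesis using lt[of "R * z"] E(5)[of "R * z"] by (simp add: u_def v_def)
  qed
  moreover have "norm (z0 / R) < 1" using z0 \<open>0 < R\<close> by (simp add: norm_divide)
  ultimately have S: "norm (u (z0 / R)) \<le> norm (z0 / R)"
    "(\<exists>z. norm z < 1 \<and> z \<noteq> 0 \<and> norm (u z) = norm z) \<or> norm (deriv u 0) = 1
      \<Longrightarrow> \<exists>\<alpha>. (\<forall>z. norm z < 1 \<longrightarrow> u z = \<alpha> * z) \<and> norm \<alpha> = 1"
    using Schwarz_Lemma[of u "z0 / R"] by blast+
  have uz0: "u (z0 / R) = v z0" using \<open>0 < R\<close> by (simp add: u_def)
  then show "norm (F3 z0) * exp (phi (F1 z0) (F2 z0)) \<le> norm z0 / R"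
    using S(1) vz0 \<open>0 < R\<close> by (simp add: norm_divide)
  assume eq: "\<And>z. z \<in> ball 0 R - {0} \<Longrightarrow> norm (F3 z) * exp (phi (F1 z) (F2 z)) = norm z / R"
  \<comment> \<open>The peak function touches at \<open>z0\<close>, so there the assumed equality is
    equality in the Schwarz lemma; one such point makes \<open>u\<close> linear.\<close>
  have "norm (u (z0 / R)) = norm (z0 / R)"
    using eq[OF z0] vz0 uz0 \<open>0 < R\<close> by (simp add: norm_divide)
  then obtain \<alpha> where \<alpha>: "\<And>z. norm z < 1 \<Longrightarrow> u z = \<alpha> * z" "norm \<alpha> = 1"
    using S(2) z0 \<open>0 < R\<close> \<open>norm (z0 / R) < 1\<close> by (metis DiffD2 divide_eq_0_iff insertI1 of_real_eq_0_iff order_less_irrefl)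
  have v: "v z = \<alpha> * z / R" if "z \<in> ball 0 R" for z
    using \<alpha>(1)[of "z / R"] that \<open>0 < R\<close> by (simp add: u_def norm_divide)
  \<comment> \<open>The peak function now has modulus exactly \<open>norm z / R\<close>, the same as
    its upper bound; the surplus factor in between must be 1, so both squares vanish.\<close>
  have const: "F1 z = F1 z0 \<and> F2 z = F2 z0" if z: "z \<in> ball 0 R - {0}" for z
  proof -
    let ?g = "(norm (F1 z - F1 z0))\<^sup>2 + (norm ((F2 z - cnj (F1 z)) - (F2 z0 - cnj (F1 z0))))\<^sup>2"
    have "norm (v z) = norm z / R"
      using v[of z] z \<alpha>(2) \<open>0 < R\<close> by (simp add: norm_mult norm_divide)
    then have "norm z / R * exp ?g \<le> norm z / R"
      using E(4)[of z] eq[OF z] unfolding v_def by simp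
    moreover have "0 < norm z / R" using z \<open>0 < R\<close> by simp
    ultimately have "exp ?g \<le> 1"
      by (metis mult.right_neutral mult_le_cancel_left_pos)
    then have "?g \<le> 0" by simp
    then have "(norm (F1 z - F1 z0))\<^sup>2 = 0" "(norm ((F2 z - cnj (F1 z)) - (F2 z0 - cnj (F1 z0))))\<^sup>2 = 0"
      by (smt (verit) zero_le_power2)+
    then show ?thesis by simp
  qed
  have "F3 z = z * (\<alpha> / R * exp (- E z0))" if z: "z \<in> ball 0 R - {0}" for z
  proof -
    have "F3 z * exp (E z0) = \<alpha> * z / R"
      using v[of z] z E(3)[of z] const[OF z] by (simp add: v_def)
    moreover have "F3 z = (F3 z * exp (E z0)) * exp (- E z0)" by (simp add: exp_minus)
    ultimately show ?thesis by simp
  qed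
  then show "\<exists>a. \<forall>z\<in>ball 0 R - {0}. F1 z = F1 z0 \<and> F2 z = F2 z0 \<and> F3 z = z * a"
    using const by blast
qed

section \<open>Growth of entire functions\<close>

text \<open>The Moebius map \<open>a / (2 * M - a)\<close> sends the half-plane
  \<open>Re a < M\<close> into the unit disc and fixes 0. The Schwarz lemma at half the radius then
  gives \<open>2 * norm (g z) \<le> norm (2 * M - g z)\<close>.\<close>

lemma Borel_Caratheodory:
  assumes "0 < r" and hol: "g holomorphic_on ball 0 (2 * r)"
    and M: "\<And>z. z \<in> ball 0 (2 * r) \<Longrightarrow> Re (g z) < M" and g0: "g 0 = 0" and z: "norm z \<le> r"
  shows "norm (g z) \<le> 2 * M"
proof -
  have "0 < M" using M[of 0] g0 \<open>0 < r\<close> by simp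
  define u where "u = (\<lambda>z. g (of_real (2 * r) * z) / (of_real (2 * M) - g (of_real (2 * r) * z)))"
  have inb: "2 * r * w \<in> ball 0 (2 * r)" if "norm w < 1" for w :: complex
    using that \<open>0 < r\<close> by (simp add: norm_mult)
  have ne: "2 * M - g (2 * r * w) \<noteq> 0" if "norm w < 1" for w :: complex
    using M[OF inb[OF that]] \<open>0 < M\<close> by (auto simp: complex_eq_iff)
  have "(\<lambda>w. g (2 * r * w)) holomorphic_on ball 0 1"
    using inb hol by (intro holomorphic_on_compose_gen[of "\<lambda>z. 2 * r * z" _ g, unfolded o_def])
      (auto intro!: holomorphic_intros)
  then have "u holomorphic_on ball 0 1"
    unfolding u_def using ne by (intro holomorphic_intros) auto
  moreover have "u 0 = 0" by (simp add: u_def g0)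
  moreover have "norm (u w) < 1" if w: "norm w < 1" for w :: complex
  proof -
    let ?a = "g (2 * r * w)"
    have "Re ?a < M" using M[OF inb[OF w]] .
    \<comment> \<open>This quantity is the difference of the squared moduli of
      \<open>2 * M - a\<close> and \<open>a\<close>.\<close>
    then have "0 < 4 * M * (M - Re ?a)" using \<open>0 < M\<close> by simp
    then have "(norm ?a)\<^sup>2 < (norm (2 * M - ?a))\<^sup>2"
      unfolding cmod_power2 by (simp add: power2_eq_square algebra_simps)
    then have "norm ?a < norm (2 * M - ?a)" by (simp add: power_less_imp_less_base)
    then show ?thesis using ne[OF w] by (simp add: u_def norm_divide)
  qed
  moreover have zr: "norm (z / (2 * r)) \<le> 1 / 2" using z \<open>0 < r\<close> by (simp add: norm_divide field_simps)
  moreover from zr have "norm (z / (2 * r)) < 1" by linarith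
  ultimately have "norm (u (z / (2 * r))) \<le> norm (z / (2 * r))"
    by (intro Schwarz_Lemma(1))
  then have "norm (u (z / (2 * r))) \<le> 1 / 2" using zr by linarith
  then have "norm (g z / (2 * M - g z)) \<le> 1 / 2" using \<open>0 < r\<close> by (simp add: u_def)
  moreover have "2 * M - g z \<noteq> 0"
    using ne[OF \<open>norm (z / (2 * r)) < 1\<close>] \<open>0 < r\<close> by simp
  ultimately have "2 * norm (g z) \<le> norm (2 * M - g z)" by (simp add: norm_divide field_simps)
  also have "\<dots> \<le> 2 * M + norm (g z)"
    using norm_triangle_ineq4[of "2 * M" "g z"] \<open>0 < M\<close> by simp
  finally show ?thesis by simp
qed

lemma quadratic_growth_imp_affine:
  assumes F: "F holomorphic_on UNIV" and A: "\<And>z. 1 \<le> norm z \<Longrightarrow> (norm (F z))\<^sup>2 \<le> A * (norm z)\<^sup>2"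
  shows "F z = F 0 + z * deriv F 0"
proof -
  have "0 \<le> A" using order_trans[OF zero_le_power2 A[of 1]] by simp
  have "norm (F z) \<le> sqrt A * norm z ^ 1" if "1 \<le> norm z" for z :: complex
    using A[OF that] real_le_rsqrt[of "norm (F z)" "A * (norm z)\<^sup>2"] by (simp add: real_sqrt_mult)
  then have "F z = (\<Sum>k\<le>1. (deriv ^^ k) F 0 / fact k * z ^ k)"
    by (rule Liouville_polynomial[OF F])
  then show ?thesis by simp
qed

text \<open>With \<open>h = exp g\<close>, the balance bounds \<open>Re g\<close> only from above,
  since \<open>phi\<close> is nonnegative. A bound on \<open>phi\<close> needs \<open>Re g\<close>
  from below too; Borel-Caratheodory supplies it at the price of a constant factor, so the growth
  stays quadratic.\<close>

lemma entire_balance_affine: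
  assumes hol: "F1 holomorphic_on UNIV" "F2 holomorphic_on UNIV" "h holomorphic_on UNIV"
    and nz: "\<And>z. h z \<noteq> 0"
    and bal: "\<And>z. norm (h z) * exp (phi (F1 z) (F2 z)) \<le> exp (C * (1 + (norm z)\<^sup>2))"
  shows "F1 z = F1 0 + z * deriv F1 0" and "F2 z = F2 0 + z * deriv F2 0"
proof -
  obtain g where g: "g holomorphic_on UNIV" "\<And>z. exp (g z) = h z"
    using holomorphic_logarithm_exists[of UNIV h 0] hol(3) nz by auto
  have sum: "Re (g z) + phi (F1 z) (F2 z) \<le> C * (1 + (norm z)\<^sup>2)" for z
    using bal[of z] unfolding g(2)[symmetric] by (simp flip: exp_add)
  \<comment> \<open>\<open>M r\<close> dominates \<open>Re (g w - g 0)\<close> on the disc of radius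
    \<open>2 * r\<close>; the final 1 makes the bound strict.\<close>
  define M where "M = (\<lambda>r::real. \<bar>C\<bar> * (1 + (2 * r)\<^sup>2) + norm (g 0) + 1)"
  have gb: "norm (g z - g 0) \<le> 2 * M (norm z)" if "1 \<le> norm z" for z :: complex
  proof (rule Borel_Caratheodory[of "norm z" "\<lambda>z. g z - g 0"])
    fix w :: complex assume w: "w \<in> ball 0 (2 * norm z)"
    have "Re (g w) \<le> C * (1 + (norm w)\<^sup>2)" using sum[of w] phi_nonneg[of "F1 w" "F2 w"] by linarith
    also have "\<dots> \<le> \<bar>C\<bar> * (1 + (norm w)\<^sup>2)" by (intro mult_right_mono) auto
    also have "\<dots> \<le> \<bar>C\<bar> * (1 + (2 * norm z)\<^sup>2)"
      using w by (intro mult_left_mono add_left_mono power_mono) auto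
    finally show "Re (g w - g 0) < M (norm z)"
      using abs_Re_le_cmod[of "g 0"] by (simp add: M_def)
  qed (use that g(1) in \<open>auto intro!: holomorphic_intros holomorphic_on_subset[OF g(1)]\<close>)
  define A where "A = 20 * \<bar>C\<bar> + 3 * norm (g 0) + 2"
  have phi: "phi (F1 z) (F2 z) \<le> A * (norm z)\<^sup>2" if z: "1 \<le> norm z" for z :: complex
  proof -
    have z2: "1 \<le> (norm z)\<^sup>2" using z by simp
    have "- Re (g z) \<le> norm (g z - g 0) + norm (g 0)"
      using abs_Re_le_cmod[of "g z"] norm_triangle_sub[of "g z" "g 0"] by linarith
    then have "phi (F1 z) (F2 z) \<le> C * (1 + (norm z)\<^sup>2) + 2 * M (norm z) + norm (g 0)"
      using sum[of z] gb[OF z] by linarith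
    also have "\<dots> \<le> \<bar>C\<bar> * (1 + (norm z)\<^sup>2) + 2 * M (norm z) + norm (g 0)"
      by (intro add_right_mono mult_right_mono) auto
    also have "\<dots> = \<bar>C\<bar> * (3 + 9 * (norm z)\<^sup>2) + 3 * norm (g 0) + 2"
      by (simp add: M_def power_mult_distrib algebra_simps)
    also have "\<dots> \<le> \<bar>C\<bar> * (20 * (norm z)\<^sup>2) + 3 * norm (g 0) * (norm z)\<^sup>2 + 2 * (norm z)\<^sup>2"
      using z2 by (intro add_mono mult_left_mono) (auto simp: mult_left_le_one_le mult_le_cancel_left1)
    also have "\<dots> = A * (norm z)\<^sup>2" by (simp add: A_def algebra_simps)
    finally show ?thesis .
  qed
  show "F1 z = F1 0 + z * deriv F1 0"
    by (rule quadratic_growth_imp_affine[OF hol(1), of A])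
      (use phi phi_ge_norm_p order_trans in blast)
  show "F2 z = F2 0 + z * deriv F2 0"
  proof (rule quadratic_growth_imp_affine[OF hol(2), of "2 * A"])
    fix z :: complex assume "1 \<le> norm z"
    from phi[OF this] phi_ge_norm_q[of "F2 z" "F1 z"]
    show "(norm (F2 z))\<^sup>2 \<le> 2 * A * (norm z)\<^sup>2" by linarith
  qed
qed

subsection \<open>The domain and the fibrewise structure of its automorphisms\<close>

definition heis_domain :: "(complex ^ 3) set" where
  "heis_domain = {x. x $ 3 \<noteq> 0 \<and> norm (x $ 3) * exp (phi (x $ 1) (x $ 2)) < 1}"

lemma vector3_in_heis_domain [simp]:
  "vector [p, q, z] \<in> heis_domain \<longleftrightarrow> z \<noteq> 0 \<and> norm z * exp (phi p q) < 1"
  by (simp add: heis_domain_def)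

lemma vector3_eta: "vector [x $ 1, x $ 2, x $ 3] = (x :: complex ^ 3)"
  by (simp add: vec_eq_iff forall_3)

lemma vector3_eq_iff:
  "vector [a, b, c] = (vector [a', b', c'] :: complex ^ 3) \<longleftrightarrow> a = a' \<and> b = b' \<and> c = c'"
  by (simp add: vec_eq_iff forall_3)

lemma open_heis_domain: "open heis_domain"
proof -
  have "open {x :: complex ^ 3. x $ 3 \<noteq> 0}"
    by (intro open_Collect_neq continuous_intros)
  moreover have "open {x :: complex ^ 3. norm (x $ 3) * exp (phi (x $ 1) (x $ 2)) < 1}"
    by (intro open_Collect_less continuous_intros)
  ultimately show ?thesis unfolding heis_domain_def Collect_conj_eq by (rule open_Int)
qed

lemma fibre_eq: "vector [p, q, z] \<in> heis_domain \<longleftrightarrow> z \<in> ball 0 (exp (- phi p q)) - {0}"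
  by (auto simp: exp_minus field_simps)

lemma holomorphic_on_complex_line:
  assumes "holomorphic_map_on f heis_domain"
    and "\<And>\<zeta>. \<zeta> \<in> S \<Longrightarrow> vector [p + \<zeta> * u, q + \<zeta> * v, z + \<zeta> * w] \<in> heis_domain"
  shows "(\<lambda>\<zeta>. f (vector [p + \<zeta> * u, q + \<zeta> * v, z + \<zeta> * w]) $ i) holomorphic_on S"
proof -
  have eq: "vector [p + \<zeta> * u, q + \<zeta> * v, z + \<zeta> * w]
      = vector [p, q, z] + \<zeta> *s (vector [u, v, w] :: complex ^ 3)" for \<zeta>
    by (simp add: vec_eq_iff forall_3)
  show ?thesis
    using holomorphic_on_subset[OF holomorphic_map_on_line[OF assms(1) open_heis_domain]] assms(2)
    unfolding eq by blast
qed

lemma biholomorphic_map_inverse: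
  assumes f: "biholomorphic_map D D f"
  shows "biholomorphic_map D D (inv_into D f)"
proof -
  have b: "bij_betw f D D" and h: "holomorphic_map_on f D" "holomorphic_map_on (inv_into D f) D"
    using f by (auto simp: biholomorphic_map_def)
  have bi: "bij_betw (inv_into D f) D D" using b by (rule bij_betw_inv_into)
  have "inv_into D (inv_into D f) x = f x" if "x \<in> D" for x
    using that b by (metis bij_betw_imp_inj_on bij_betw_imp_surj_on bij_betwE inv_into_f_eq bi
        inv_into_f_f)
  then have "holomorphic_map_on (inv_into D (inv_into D f)) D"
    using h(1) holomorphic_map_on_cong by metis
  then show ?thesis using bi h(2) by (simp add: biholomorphic_map_def)
qed

lemma automorphism_fibre_extension:
  fixes p q :: complex
  assumes f: "biholomorphic_map heis_domain heis_domain f"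
  defines "R \<equiv> exp (- phi p q)"
  obtains F1 F2 F3 where "F1 holomorphic_on ball 0 R" "F2 holomorphic_on ball 0 R"
    "F3 holomorphic_on ball 0 R" "F3 0 = 0"
    "\<And>z. z \<in> ball 0 R - {0} \<Longrightarrow> f (vector [p, q, z]) = vector [F1 z, F2 z, F3 z]"
    "\<And>z. z \<in> ball 0 R - {0} \<Longrightarrow> norm (F3 z) * exp (phi (F1 z) (F2 z)) < 1"
proof -
  have R: "0 < R" by (simp add: R_def)
  have b: "bij_betw f heis_domain heis_domain" and h: "holomorphic_map_on f heis_domain"
    and hi: "holomorphic_map_on (inv_into heis_domain f) heis_domain"
    using f by (auto simp: biholomorphic_map_def)
  let ?c = "\<lambda>z. vector [p, q, z] :: complex ^ 3"
  have c: "?c z \<in> heis_domain" "f (?c z) \<in> heis_domain" if "z \<in> ball 0 R - {0}" for z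
    using that b unfolding R_def fibre_eq[symmetric] by (auto dest: bij_betwE)
  have hol: "(\<lambda>z. f (?c z) $ i) holomorphic_on ball 0 R - {0}" for i
    using holomorphic_on_complex_line[OF h, of "ball 0 R - {0}" p 0 q 0 0 1 i] c(1) by simp
  have D: "f (?c z) $ 3 \<noteq> 0" "norm (f (?c z) $ 3) * exp (phi (f (?c z) $ 1) (f (?c z) $ 2)) < 1"
    if "z \<in> ball 0 R - {0}" for z
    using c(2)[OF that] by (simp_all add: heis_domain_def)
  obtain F1 F2 F3 where F: "F1 holomorphic_on ball 0 R" "F2 holomorphic_on ball 0 R"
      "F3 holomorphic_on ball 0 R"
      "\<And>z. z \<in> ball 0 R - {0} \<Longrightarrow> F1 z = f (?c z) $ 1 \<and> F2 z = f (?c z) $ 2 \<and> F3 z = f (?c z) $ 3"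
    by (rule fibre_extension[OF R hol[of 1] hol[of 2] hol[of 3] D]) blast+
  have eq: "f (?c z) = vector [F1 z, F2 z, F3 z]" if "z \<in> ball 0 R - {0}" for z
    using F(4)[OF that] by (simp add: vector3_eta)
  have lt: "norm (F3 z) * exp (phi (F1 z) (F2 z)) < 1" if "z \<in> ball 0 R - {0}" for z
    using F(4)[OF that] D(2)[OF that] by simp
  \<comment> \<open>If not, the limit point lies in the domain. Continuity of the inverse of
    \<open>f\<close> there would make the points \<open>vector [p, q, z]\<close> converge inside the
    domain as \<open>z\<close> tends to 0, where the last coordinate cannot vanish.\<close>
  have "F3 0 = 0"
  proof (rule ccontr)
    assume "F3 0 \<noteq> 0"
    let ?y = "vector [F1 0, F2 0, F3 0] :: complex ^ 3" and ?g = "inv_into heis_domain f"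
    have y: "?y \<in> heis_domain"
      using fibre_limit_interior[OF R F(1-3) lt] \<open>F3 0 \<noteq> 0\<close> by simp
    have ev: "\<forall>\<^sub>F z in at 0. z \<in> ball 0 R - {0}"
      unfolding eventually_at by (rule exI[of _ R]) (use R in \<open>auto simp: dist_commute\<close>)
    have "isCont F 0" if "F holomorphic_on ball 0 R" for F
      using that R by (meson centre_in_ball continuous_on_eq_continuous_at
          holomorphic_on_imp_continuous_on open_ball)
    then have "\<forall>i. ((\<lambda>z. (vector [F1 z, F2 z, F3 z] :: complex ^ 3) $ i) \<longlongrightarrow> ?y $ i) (at 0)"
      unfolding forall_3 using F(1-3) by (simp add: isCont_def)
    then have "((\<lambda>z. vector [F1 z, F2 z, F3 z] :: complex ^ 3) \<longlongrightarrow> ?y) (at 0)"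
      by (simp add: vec_tendstoI)
    moreover have "isCont ?g ?y"
      using holomorphic_map_on_imp_continuous_on[OF hi] y open_heis_domain
      by (simp add: continuous_on_eq_continuous_at)
    ultimately have "((\<lambda>z. ?g (vector [F1 z, F2 z, F3 z])) \<longlongrightarrow> ?g ?y) (at 0)"
      by (rule isCont_tendsto_compose[rotated])
    moreover have "\<forall>\<^sub>F z in at 0. ?g (vector [F1 z, F2 z, F3 z]) = ?c z"
      using ev
    proof (rule eventually_mono)
      fix z :: complex assume z: "z \<in> ball 0 R - {0}"
      show "?g (vector [F1 z, F2 z, F3 z]) = ?c z"
        unfolding eq[OF z, symmetric] by (rule bij_betw_inv_into_left[OF b c(1)[OF z]])
    qed
    ultimately have "(?c \<longlongrightarrow> ?g ?y) (at 0)" by (rule Lim_transform_eventually)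
    then have "((\<lambda>z. ?c z $ 3) \<longlongrightarrow> ?g ?y $ 3) (at 0)" by (rule tendsto_vec_nth)
    then have "((\<lambda>z. z) \<longlongrightarrow> ?g ?y $ 3) (at 0)" by simp
    then have "?g ?y $ 3 = 0" by (rule LIM_unique[OF _ tendsto_ident_at])
    moreover have "?g ?y \<in> heis_domain" using y b by (metis bij_betwE bij_betw_inv_into)
    ultimately show False by (simp add: heis_domain_def)
  qed
  then show thesis using that F(1-3) eq lt by blast
qed

text \<open>The modulus of the last coordinate measured in units of the radius of its fibre.\<close>

definition rho :: "complex ^ 3 \<Rightarrow> real" where
  "rho x = norm (x $ 3) * exp (phi (x $ 1) (x $ 2))"

lemma automorphism_rho_le:
  assumes f: "biholomorphic_map heis_domain heis_domain f" and x: "x \<in> heis_domain"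
  shows "rho (f x) \<le> rho x"
proof -
  define p q z where "p = x $ 1" "q = x $ 2" "z = x $ 3"
  have x_eq: "x = vector [p, q, z]" by (simp add: p_q_z_def vector3_eta)
  define R where "R = exp (- phi p q)"
  have R: "0 < R" and z: "z \<in> ball 0 R - {0}"
    using x unfolding x_eq fibre_eq R_def by auto
  obtain F1 F2 F3 where F: "F1 holomorphic_on ball 0 R" "F2 holomorphic_on ball 0 R"
    "F3 holomorphic_on ball 0 R" "F3 0 = 0"
    "\<And>z. z \<in> ball 0 R - {0} \<Longrightarrow> f (vector [p, q, z]) = vector [F1 z, F2 z, F3 z]"
    "\<And>z. z \<in> ball 0 R - {0} \<Longrightarrow> norm (F3 z) * exp (phi (F1 z) (F2 z)) < 1"
    unfolding R_def by (rule automorphism_fibre_extension[OF f, of p q]) blast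
  have "rho (f x) = norm (F3 z) * exp (phi (F1 z) (F2 z))"
    unfolding x_eq F(5)[OF z] rho_def by simp
  also have "\<dots> \<le> norm z / R" by (rule fibre_schwarz(1)[OF R F(1-3,6,4) z])
  also have "\<dots> = rho x" by (simp add: x_eq rho_def R_def exp_minus field_simps)
  finally show ?thesis .
qed

lemma automorphism_rho:
  assumes f: "biholomorphic_map heis_domain heis_domain f" and x: "x \<in> heis_domain"
  shows "rho (f x) = rho x"
proof (rule antisym)
  show "rho (f x) \<le> rho x" by (rule automorphism_rho_le[OF f x])
  have b: "bij_betw f heis_domain heis_domain" using f by (simp add: biholomorphic_map_def)
  then have "inv_into heis_domain f (f x) = x" "f x \<in> heis_domain"
    using x by (auto simp: bij_betw_inv_into_left dest: bij_betwE)
  then show "rho x \<le> rho (f x)"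
    using automorphism_rho_le[OF biholomorphic_map_inverse[OF f], of "f x"] by simp
qed

lemma automorphism_fibre_linear:
  assumes f: "biholomorphic_map heis_domain heis_domain f"
  shows "\<exists>P Q h. \<forall>p q z. vector [p, q, z] \<in> heis_domain \<longrightarrow>
    f (vector [p, q, z]) = vector [P p q, Q p q, z * h p q]"
proof -
  have "\<exists>a b c. \<forall>z. vector [p, q, z] \<in> heis_domain \<longrightarrow> f (vector [p, q, z]) = vector [a, b, z * c]" for p q
  proof -
    define R where "R = exp (- phi p q)"
    have R: "0 < R" by (simp add: R_def)
    \<comment> \<open>A reference point of the punctured fibre, at which the constant values of the
      base components are read off.\<close>
    have z0: "of_real (R / 2) \<in> ball 0 R - {0::complex}" using R by simp
    obtain F1 F2 F3 where F: "F1 holomorphic_on ball 0 R" "F2 holomorphic_on ball 0 R"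
      "F3 holomorphic_on ball 0 R" "F3 0 = 0"
      "\<And>z. z \<in> ball 0 R - {0} \<Longrightarrow> f (vector [p, q, z]) = vector [F1 z, F2 z, F3 z]"
      "\<And>z. z \<in> ball 0 R - {0} \<Longrightarrow> norm (F3 z) * exp (phi (F1 z) (F2 z)) < 1"
      unfolding R_def by (rule automorphism_fibre_extension[OF f, of p q]) blast
    have "norm (F3 z) * exp (phi (F1 z) (F2 z)) = norm z / R" if z: "z \<in> ball 0 R - {0}" for z
    proof -
      have "vector [p, q, z] \<in> heis_domain" unfolding fibre_eq using z by (simp add: R_def)
      from automorphism_rho[OF f this] show ?thesis
        unfolding F(5)[OF z] rho_def by (simp add: R_def exp_minus field_simps)
    qed
    from fibre_schwarz(2)[OF R F(1-3,6,4) z0 this] obtain a where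
      "\<forall>z\<in>ball 0 R - {0}. F1 z = F1 (of_real (R / 2)) \<and> F2 z = F2 (of_real (R / 2)) \<and> F3 z = z * a"
      by blast
    then have "f (vector [p, q, z]) = vector [F1 (of_real (R / 2)), F2 (of_real (R / 2)), z * a]"
      if "z \<in> ball 0 R - {0}" for z
      using F(5)[OF that] that by metis
    then show ?thesis unfolding fibre_eq R_def[symmetric] by blast
  qed
  then show ?thesis by metis
qed

text \<open>The point \<open>(p, q)\<close> is the midpoint of \<open>(2 * p, 0)\<close> and
  \<open>(0, 2 * q)\<close>, so three lines reduce everything to the values at
  \<open>(0, 0)\<close>, \<open>(1, 0)\<close> and \<open>(0, 1)\<close>.\<close>

lemma affine_on_lines_imp_affine:
  fixes P :: "complex \<Rightarrow> complex \<Rightarrow> complex"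
  assumes P: "\<And>p q u v. \<exists>c. \<forall>\<zeta>. P (p + \<zeta> * u) (q + \<zeta> * v) = P p q + \<zeta> * c"
  shows "P p q = P 0 0 + p * (P 1 0 - P 0 0) + q * (P 0 1 - P 0 0)"
proof -
  have line: "P (p + \<zeta> * u) (q + \<zeta> * v) = P p q + \<zeta> * (P (p + u) (q + v) - P p q)" for p q u v \<zeta>
  proof -
    obtain c where c: "\<And>\<zeta>. P (p + \<zeta> * u) (q + \<zeta> * v) = P p q + \<zeta> * c" using P by blast
    show ?thesis using c[of 1] c[of \<zeta>] by simp
  qed
  have 1: "P p q = P (2 * p) 0 + 1 / 2 * (P 0 (2 * q) - P (2 * p) 0)"
    using line[of "2 * p" "1 / 2" "- 2 * p" 0 "2 * q"] by simp
  have 2: "P (2 * p) 0 = P 0 0 + 2 * p * (P 1 0 - P 0 0)"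
    using line[of 0 "2 * p" 1 0 0] by simp
  have 3: "P 0 (2 * q) = P 0 0 + 2 * q * (P 0 1 - P 0 0)"
    using line[of 0 "2 * q" 0 0 1] by simp
  show ?thesis unfolding 1 2 3 by (simp add: field_simps)
qed

subsection \<open>Rigidity of the base map\<close>

text \<open>The jump at 0 of the one-sided derivatives of \<open>g\<close>.\<close>

definition kink :: "(real \<Rightarrow> real) \<Rightarrow> real \<Rightarrow> bool" where
  "kink g c \<longleftrightarrow> ((\<lambda>t. (g t + g (- t) - 2 * g 0) / t) \<longlongrightarrow> c) (at_right 0)"

lemma kink_unique: "kink g c \<Longrightarrow> kink g d \<Longrightarrow> c = d"
  unfolding kink_def by (rule tendsto_unique[OF trivial_limit_at_right_real])

lemma kink_add: "kink f c \<Longrightarrow> kink g d \<Longrightarrow> kink (\<lambda>t. f t + g t) (c + d)"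
  unfolding kink_def by (drule (1) tendsto_add) (simp add: add_divide_distrib diff_divide_distrib algebra_simps)

lemma kink_cmult: "kink f c \<Longrightarrow> kink (\<lambda>t. a * f t) (a * c)"
  unfolding kink_def by (drule tendsto_mult[OF tendsto_const[of a]]) (simp add: algebra_simps)

text \<open>The symmetrised function \<open>g t + g (- t)\<close> has derivative
  \<open>d - d = 0\<close> at 0.\<close>

lemma kink_differentiable:
  assumes "(g has_real_derivative d) (at 0)"
  shows "kink g 0"
proof -
  have g: "(g has_real_derivative d) (at (- 0))" using assms by simp
  have "((\<lambda>t. g t + g (- t)) has_real_derivative d + d * - 1) (at 0)"
    by (rule DERIV_add[OF assms DERIV_chain2[where f = g and g = uminus, OF g]]) (auto intro!: derivative_eq_intros)
  then have "((\<lambda>t. (g t + g (- t) - 2 * g 0) / t) \<longlongrightarrow> 0) (at 0)"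
    by (simp add: DERIV_def)
  then show ?thesis
    unfolding kink_def by (rule filterlim_mono) (auto simp: at_le)
qed

lemma kink_norm:
  fixes w l :: complex
  shows "kink (\<lambda>t. norm (w + of_real t * l)) (if w = 0 then 2 * norm l else 0)"
proof (cases "w = 0")
  case True
  have "\<forall>\<^sub>F t in at_right 0. (norm (of_real t * l) + norm (of_real (- t) * l) - 2 * norm (of_real 0 * l)) / t
      = 2 * norm l"
    using eventually_at_right_less by (rule eventually_mono) (simp add: norm_mult)
  then show ?thesis unfolding kink_def using True by (simp add: tendsto_eventually)
next
  case False
  have "(norm has_derivative (\<lambda>x. x \<bullet> sgn w)) (at (w + of_real 0 * l))"
    using has_derivative_norm[OF False] by simp
  moreover have "((\<lambda>t. w + of_real t * l) has_derivative (\<lambda>t. of_real t * l)) (at 0)"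
    by (auto intro!: derivative_eq_intros)
  ultimately have "((\<lambda>t. norm (w + of_real t * l)) has_derivative (\<lambda>t. (of_real t * l) \<bullet> sgn w)) (at 0)"
    by (rule has_derivative_compose[rotated])
  moreover have "(\<lambda>t. (of_real t * l) \<bullet> sgn w) = (*) (l \<bullet> sgn w)"
    by (auto simp: scaleR_conv_of_real[symmetric])
  ultimately have "((\<lambda>t. norm (w + of_real t * l)) has_real_derivative l \<bullet> sgn w) (at 0)"
    unfolding has_field_derivative_def by simp
  from kink_differentiable[OF this] show ?thesis using False by simp
qed

lemma kink_norm_power2:
  fixes w l :: complex
  shows "kink (\<lambda>t. (norm (w + of_real t * l))\<^sup>2) 0"
  unfolding cmod_power2
  by (rule kink_differentiable) (auto intro!: derivative_eq_intros)

text \<open>The coefficient in \<open>chi\<close> of the cone with vertex \<open>w\<close>, and 0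
  where \<open>chi\<close> has no cone point.\<close>

definition weight :: "complex \<Rightarrow> real" where
  "weight w = (if w = 0 then 1 else 0) + (if w = 1 then 2 else 0) + (if w = \<i> then 4 else 0)"

text \<open>Along a real line, \<open>q - cnj p\<close> moves with velocity
  \<open>v - cnj u\<close>; a cone contributes only if its vertex is the starting point.\<close>

lemma kink_phi:
  "kink (\<lambda>t. phi (p + of_real t * u) (q + of_real t * v)) (2 * weight (q - cnj p) * norm (v - cnj u))"
proof -
  define w l where "w = q - cnj p" and "l = v - cnj u"
  have eq: "(q + of_real t * v) - cnj (p + of_real t * u) = w + of_real t * l" for t
    by (simp add: w_def l_def algebra_simps)
  have shift: "w + of_real t * l - k = (w - k) + of_real t * l" for t k by simp
  have "kink (\<lambda>t. pi / 2 * (norm (p + of_real t * u))\<^sup>2 + ((norm (w + of_real t * l))\<^sup>2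
      + norm (w + of_real t * l) + 2 * norm (w - 1 + of_real t * l) + 4 * norm (w - \<i> + of_real t * l)))
    (pi / 2 * 0 + (0 + (if w = 0 then 2 * norm l else 0) + 2 * (if w - 1 = 0 then 2 * norm l else 0)
      + 4 * (if w - \<i> = 0 then 2 * norm l else 0)))"
    by (intro kink_add kink_cmult kink_norm kink_norm_power2)
  moreover have "pi / 2 * 0 + (0 + (if w = 0 then 2 * norm l else 0) + 2 * (if w - 1 = 0 then 2 * norm l else 0)
      + 4 * (if w - \<i> = 0 then 2 * norm l else 0)) = 2 * weight w * norm l"
    by (simp add: weight_def)
  ultimately show ?thesis
    unfolding phi_def chi_def eq shift w_def[symmetric] l_def[symmetric] by metis
qed

text \<open>\<open>ln (norm k)\<close> is the real part of an entire logarithm of \<open>k\<close>,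
  hence differentiable. This removes the factor \<open>h\<close> from the comparison of
  kinks.\<close>

lemma kink_ln_norm:
  assumes hol: "k holomorphic_on UNIV" and nz: "\<And>z. k z \<noteq> 0"
  shows "kink (\<lambda>t. ln (norm (k (of_real t)))) 0"
proof -
  obtain g where g: "g holomorphic_on UNIV" "\<And>z. exp (g z) = k z"
    using holomorphic_logarithm_exists[of UNIV k 0] hol nz by auto
  have "(g has_field_derivative deriv g 0) (at (of_real 0))"
    using holomorphic_derivI[OF g(1), of 0] by simp
  then have "((\<lambda>t. g (of_real t)) has_vector_derivative deriv g 0) (at 0)"
    by (rule has_vector_derivative_real_field)
  then have "((\<lambda>t. Re (g (of_real t))) has_real_derivative Re (deriv g 0)) (at 0)"
    by (simp add: has_vector_derivative_complex_iff)
  then show ?thesis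
    unfolding g(2)[symmetric] using kink_differentiable by simp
qed

text \<open>The cone points 0, 1, \<open>\<i>\<close> are hit by \<open>(0, 0)\<close>,
  \<open>(0, 1)\<close>, \<open>(0, \<i>)\<close>. Their kinks in the direction
  \<open>(0, 1)\<close> are all rescaled by the same stretch, so the ratios 1 : 2 : 4 of the weights
  survive and identify each image cone point.\<close>

lemma weight_rigidity:
  fixes a11 a12 a21 a22 b1 b2 :: complex
  assumes inv: "\<And>p q u v. weight ((b2 + p * a21 + q * a22) - cnj (b1 + p * a11 + q * a12))
      * norm ((u * a21 + v * a22) - cnj (u * a11 + v * a12)) = weight (q - cnj p) * norm (v - cnj u)"
  shows "a11 = 1" "a12 = 0" "a21 = 0" "a22 = 1" "b2 = cnj b1"
proof -
  \<comment> \<open>The values of \<open>q - cnj p\<close> at the images of \<open>(0, 0)\<close>,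
    \<open>(0, 1)\<close> and \<open>(0, \<i>)\<close>.\<close>
  define \<beta> s t where "\<beta> = b2 - cnj b1" "s = \<beta> + (a22 - cnj a12)" "t = \<beta> + \<i> * (a22 + cnj a12)"
  have s_eq: "(b2 + a22) - cnj (b1 + a12) = s" and t_eq: "(b2 + \<i> * a22) - cnj (b1 + \<i> * a12) = t"
    by (simp_all add: \<beta>_s_t_def algebra_simps)
  have w: "weight 0 = 1" "weight 1 = 2" "weight \<i> = 4" by (simp_all add: weight_def complex_eq_iff)
  let ?n = "norm (a22 - cnj a12)"
  have 1: "weight \<beta> * ?n = 1" using inv[of 0 0 0 1] w by (simp add: \<beta>_s_t_def(1))
  have 2: "weight s * ?n = 2" using inv[of 0 1 0 1] w s_eq by simp
  have 3: "weight t * ?n = 4" using inv[of 0 \<i> 0 1] w t_eq by simp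
  have nz: "?n \<noteq> 0" using 1 by auto
  have ws: "weight s = 2 * weight \<beta>"
  proof -
    have "weight s * ?n = (2 * weight \<beta>) * ?n" using 1 2 by simp
    then show ?thesis using nz by simp
  qed
  have wt: "weight t = 4 * weight \<beta>"
  proof -
    have "weight t * ?n = (4 * weight \<beta>) * ?n" using 1 3 by simp
    then show ?thesis using nz by simp
  qed
  \<comment> \<open>The nonzero weights are 1, 2, 4. Since twice and four times
    \<open>weight \<beta>\<close> are weights as well, it must be 1.\<close>
  have "weight \<beta> \<noteq> 0" using 1 by auto
  then have \<beta>: "\<beta> = 0" and "s = 1" and "t = \<i>"
    using ws wt unfolding weight_def by (auto split: if_splits)
  then have "a22 - cnj a12 = 1" "\<i> * (a22 + cnj a12) = \<i> * 1"
    using \<beta>_s_t_def by auto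
  then have A: "a22 - cnj a12 = 1" "a22 + cnj a12 = 1" by (metis, metis complex_i_not_zero mult_cancel_left)
  have "2 * cnj a12 = (a22 + cnj a12) - (a22 - cnj a12)" by simp
  also have "\<dots> = 0" using A by simp
  finally have "a12 = 0" by simp
  then show a: "a22 = 1" "a12 = 0" using A(1) by auto
  show "b2 = cnj b1" using \<beta> \<beta>_s_t_def(1) by simp
  \<comment> \<open>The directions \<open>(1, 1)\<close> and, next, \<open>(\<i>, - \<i>)\<close>
    satisfy \<open>v = cnj u\<close>: \<open>q - cnj p\<close> is stationary along them, so there is
    no kink, and the image direction must have the same property.\<close>
  have "norm ((a21 + a22) - cnj (a11 + a12)) = 0"
    using inv[of 0 0 1 1] w \<open>weight \<beta> \<noteq> 0\<close> \<beta> \<beta>_s_t_def(1) by simp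
  then have B: "a21 + 1 = cnj a11" using a by simp
  have "norm ((\<i> * a21 - \<i> * a22) - cnj (\<i> * a11 - \<i> * a12)) = 0"
    using inv[of 0 0 "\<i>" "- \<i>"] w \<open>weight \<beta> \<noteq> 0\<close> \<beta> \<beta>_s_t_def(1) by simp
  then have "\<i> * (a21 - 1 + cnj a11) = 0" using a by (simp add: algebra_simps)
  then have C: "a21 - 1 + cnj a11 = 0" by simp
  have "2 * a21 = 0" using C unfolding B[symmetric] by simp
  then show "a21 = 0" by simp
  then show "a11 = 1" using B by (metis add_0 complex_cnj_cnj complex_cnj_one)
qed

section \<open>Explicit form of the automorphisms\<close>

lemma entire_if_locally_holomorphic:
  assumes "\<And>z. \<exists>S. open S \<and> z \<in> S \<and> f holomorphic_on S"
  shows "f holomorphic_on UNIV"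
  unfolding holomorphic_on_def
proof
  fix z
  obtain S where "open S" "z \<in> S" "f holomorphic_on S" using assms by blast
  then show "f field_differentiable at z" by (rule holomorphic_on_imp_differentiable_at[rotated 1])
qed

lemma half_exp: "norm (complex_of_real (exp (- x) / 2)) * exp x = 1 / 2"
  unfolding norm_of_real by (simp add: exp_minus)

text \<open>\<open>P\<close>, \<open>Q\<close>, \<open>h\<close> arise from a choice over each base
  point, so their regularity has to be recovered from \<open>f\<close>. Freezing the last coordinate
  gives local sections of the domain over complex lines, along which the components of
  \<open>f\<close> are \<open>P\<close>, \<open>Q\<close> and a constant times
  \<open>h\<close>.\<close>

lemma automorphism_linear_parts:
  assumes f: "biholomorphic_map heis_domain heis_domain f"
  obtains P Q h where
    "\<And>p q z. vector [p, q, z] \<in> heis_domain \<Longrightarrow> f (vector [p, q, z]) = vector [P p q, Q p q, z * h p q]"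
    "\<And>p q. norm (h p q) * exp (phi (P p q) (Q p q)) = exp (phi p q)"
    "\<And>p q u v. (\<lambda>\<zeta>. P (p + \<zeta> * u) (q + \<zeta> * v)) holomorphic_on UNIV"
    "\<And>p q u v. (\<lambda>\<zeta>. Q (p + \<zeta> * u) (q + \<zeta> * v)) holomorphic_on UNIV"
    "\<And>p q u v. (\<lambda>\<zeta>. h (p + \<zeta> * u) (q + \<zeta> * v)) holomorphic_on UNIV"
proof -
  obtain P Q h where F: "\<And>p q z. vector [p, q, z] \<in> heis_domain \<Longrightarrow>
      f (vector [p, q, z]) = vector [P p q, Q p q, z * h p q]"
    using automorphism_fibre_linear[OF f] by blast
  have hf: "holomorphic_map_on f heis_domain" using f by (simp add: biholomorphic_map_def)
  have half: "vector [p, q, of_real (exp (- phi p q) / 2)] \<in> heis_domain" for p q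
    using half_exp[of "phi p q"] by (simp del: of_real_divide)
  have bal: "norm (h p q) * exp (phi (P p q) (Q p q)) = exp (phi p q)" for p q
    using automorphism_rho[OF f half, of p q] unfolding F[OF half] rho_def
    by (simp add: norm_mult norm_divide)
  have hol: "(\<lambda>\<zeta>. P (p + \<zeta> * u) (q + \<zeta> * v)) holomorphic_on UNIV \<and>
      (\<lambda>\<zeta>. Q (p + \<zeta> * u) (q + \<zeta> * v)) holomorphic_on UNIV \<and>
      (\<lambda>\<zeta>. h (p + \<zeta> * u) (q + \<zeta> * v)) holomorphic_on UNIV" for p q u v
  proof -
    have "\<exists>S. open S \<and> \<zeta>0 \<in> S \<and> (\<lambda>\<zeta>. P (p + \<zeta> * u) (q + \<zeta> * v)) holomorphic_on S \<and>
      (\<lambda>\<zeta>. Q (p + \<zeta> * u) (q + \<zeta> * v)) holomorphic_on S \<and>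
      (\<lambda>\<zeta>. h (p + \<zeta> * u) (q + \<zeta> * v)) holomorphic_on S" for \<zeta>0
    proof -
      \<comment> \<open>Half the radius of the fibre over the centre point: this value stays inside
        the fibres over all nearby points, which form \<open>S\<close>.\<close>
      define z0 where "z0 = complex_of_real (exp (- phi (p + \<zeta>0 * u) (q + \<zeta>0 * v)) / 2)"
      have z0: "z0 \<noteq> 0" by (simp add: z0_def)
      define S where "S = {\<zeta>. norm z0 * exp (phi (p + \<zeta> * u) (q + \<zeta> * v)) < 1}"
      have S: "vector [p + \<zeta> * u, q + \<zeta> * v, z0 + \<zeta> * 0] \<in> heis_domain" if "\<zeta> \<in> S" for \<zeta>
        using that z0 by (simp add: S_def)
      have "open S" unfolding S_def by (intro open_Collect_less continuous_intros)
      moreover have "\<zeta>0 \<in> S" using half_exp[of "phi (p + \<zeta>0 * u) (q + \<zeta>0 * v)"] by (simp add: S_def z0_def del: of_real_divide)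
      moreover have eq: "f (vector [p + \<zeta> * u, q + \<zeta> * v, z0 + \<zeta> * 0])
          = vector [P (p + \<zeta> * u) (q + \<zeta> * v), Q (p + \<zeta> * u) (q + \<zeta> * v), z0 * h (p + \<zeta> * u) (q + \<zeta> * v)]"
        if "\<zeta> \<in> S" for \<zeta>
        using F[OF S[OF that]] by simp
      have holS: "(\<lambda>\<zeta>. f (vector [p + \<zeta> * u, q + \<zeta> * v, z0 + \<zeta> * 0]) $ i) holomorphic_on S" for i
        by (rule holomorphic_on_complex_line[OF hf S])
      have "(\<lambda>\<zeta>. P (p + \<zeta> * u) (q + \<zeta> * v)) holomorphic_on S"
        using holomorphic_transform[OF holS[of 1]] eq by simp
      moreover have "(\<lambda>\<zeta>. Q (p + \<zeta> * u) (q + \<zeta> * v)) holomorphic_on S"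
        using holomorphic_transform[OF holS[of 2]] eq by simp
      moreover have "(\<lambda>\<zeta>. z0 * h (p + \<zeta> * u) (q + \<zeta> * v)) holomorphic_on S"
        using holomorphic_transform[OF holS[of 3]] eq by simp
      then have "(\<lambda>\<zeta>. (1 / z0) * (z0 * h (p + \<zeta> * u) (q + \<zeta> * v))) holomorphic_on S"
        by (rule holomorphic_on_mult[OF holomorphic_on_const])
      moreover have "(\<lambda>\<zeta>. (1 / z0) * (z0 * h (p + \<zeta> * u) (q + \<zeta> * v)))
          = (\<lambda>\<zeta>. h (p + \<zeta> * u) (q + \<zeta> * v))" using z0 by simp
      ultimately show ?thesis by (intro exI[of _ S]) (simp only:)
    qed
    then show ?thesis by (intro conjI entire_if_locally_holomorphic) blast+
  qed
  show thesis by (rule that[of P Q h]) (use F bal hol in auto)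
qed

lemma phi_line_bound:
  "phi (p + \<zeta> * u) (q + \<zeta> * v) \<le>
    (12 * (1 + 2 * (norm p)\<^sup>2 + 2 * (norm u)\<^sup>2 + 2 * (norm q)\<^sup>2 + 2 * (norm v)\<^sup>2)) * (1 + (norm \<zeta>)\<^sup>2)"
proof -
  have sq: "(norm (a + \<zeta> * b))\<^sup>2 \<le> 2 * (norm a)\<^sup>2 + 2 * (norm \<zeta>)\<^sup>2 * (norm b)\<^sup>2" for a b :: complex
  proof -
    have "norm (a + \<zeta> * b) \<le> norm a + norm \<zeta> * norm b"
      using norm_triangle_ineq[of a "\<zeta> * b"] by (simp add: norm_mult)
    then have "(norm (a + \<zeta> * b))\<^sup>2 \<le> (norm a + norm \<zeta> * norm b)\<^sup>2" by (intro power_mono) auto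
    also have "\<dots> \<le> 2 * (norm a)\<^sup>2 + 2 * (norm \<zeta>)\<^sup>2 * (norm b)\<^sup>2"
      using zero_le_power2[of "norm a - norm \<zeta> * norm b"] by (simp add: power2_eq_square algebra_simps)
    finally show ?thesis .
  qed
  have "phi (p + \<zeta> * u) (q + \<zeta> * v)
      \<le> 12 * (1 + (2 * (norm p)\<^sup>2 + 2 * (norm \<zeta>)\<^sup>2 * (norm u)\<^sup>2) + (2 * (norm q)\<^sup>2 + 2 * (norm \<zeta>)\<^sup>2 * (norm v)\<^sup>2))"
    by (rule order_trans[OF phi_le]) (intro mult_left_mono add_mono order_refl sq; simp)
  also have "\<dots> \<le> (12 * (1 + 2 * (norm p)\<^sup>2 + 2 * (norm u)\<^sup>2 + 2 * (norm q)\<^sup>2 + 2 * (norm v)\<^sup>2)) * (1 + (norm \<zeta>)\<^sup>2)"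
    by (simp add: algebra_simps)
  finally show ?thesis .
qed

theorem automorphism_form:
  assumes f: "biholomorphic_map heis_domain heis_domain f"
  obtains b c where "norm c = 1"
    "\<And>p q z. vector [p, q, z] \<in> heis_domain \<Longrightarrow> f (vector [p, q, z])
      = vector [p + b, q + cnj b, z * (c * exp (- (of_real pi * cnj b * p + of_real (pi / 2 * (norm b)\<^sup>2))))]"
proof -
  obtain P Q h where F: "\<And>p q z. vector [p, q, z] \<in> heis_domain \<Longrightarrow>
      f (vector [p, q, z]) = vector [P p q, Q p q, z * h p q]"
    and bal: "\<And>p q. norm (h p q) * exp (phi (P p q) (Q p q)) = exp (phi p q)"
    and hP: "\<And>p q u v. (\<lambda>\<zeta>. P (p + \<zeta> * u) (q + \<zeta> * v)) holomorphic_on UNIV"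
    and hQ: "\<And>p q u v. (\<lambda>\<zeta>. Q (p + \<zeta> * u) (q + \<zeta> * v)) holomorphic_on UNIV"
    and hh: "\<And>p q u v. (\<lambda>\<zeta>. h (p + \<zeta> * u) (q + \<zeta> * v)) holomorphic_on UNIV"
    by (rule automorphism_linear_parts[OF f]) blast
  have nz: "h p q \<noteq> 0" for p q
    using bal[of p q] by auto
  have lines: "(\<exists>c. \<forall>\<zeta>. P (p + \<zeta> * u) (q + \<zeta> * v) = P p q + \<zeta> * c)
      \<and> (\<exists>c. \<forall>\<zeta>. Q (p + \<zeta> * u) (q + \<zeta> * v) = Q p q + \<zeta> * c)" for p q u v
  proof -
    let ?C = "12 * (1 + 2 * (norm p)\<^sup>2 + 2 * (norm u)\<^sup>2 + 2 * (norm q)\<^sup>2 + 2 * (norm v)\<^sup>2)"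
    have "norm (h (p + \<zeta> * u) (q + \<zeta> * v)) * exp (phi (P (p + \<zeta> * u) (q + \<zeta> * v)) (Q (p + \<zeta> * u) (q + \<zeta> * v)))
        \<le> exp (?C * (1 + (norm \<zeta>)\<^sup>2))" for \<zeta>
      unfolding bal using phi_line_bound[of p \<zeta> u q v] by simp
    note A = entire_balance_affine[OF hP[of p u q v] hQ[of p u q v] hh[of p u q v] nz this]
    have "P (p + \<zeta> * u) (q + \<zeta> * v) = P p q + \<zeta> * deriv (\<lambda>\<zeta>. P (p + \<zeta> * u) (q + \<zeta> * v)) 0" for \<zeta>
      using A(1)[of \<zeta>] by simp
    moreover have "Q (p + \<zeta> * u) (q + \<zeta> * v) = Q p q + \<zeta> * deriv (\<lambda>\<zeta>. Q (p + \<zeta> * u) (q + \<zeta> * v)) 0" for \<zeta>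
      using A(2)[of \<zeta>] by simp
    ultimately show ?thesis by blast
  qed
  define b1 a11 a12 where "b1 = P 0 0" "a11 = P 1 0 - P 0 0" "a12 = P 0 1 - P 0 0"
  define b2 a21 a22 where "b2 = Q 0 0" "a21 = Q 1 0 - Q 0 0" "a22 = Q 0 1 - Q 0 0"
  have P: "P p q = b1 + p * a11 + q * a12" for p q
    unfolding b1_a11_a12_def by (rule affine_on_lines_imp_affine) (use lines in blast)
  have Q: "Q p q = b2 + p * a21 + q * a22" for p q
    unfolding b2_a21_a22_def by (rule affine_on_lines_imp_affine) (use lines in blast)
  \<comment> \<open>Taking logarithms, the balance reads
    \<open>ln (norm h) + phi (P, Q) = phi\<close>. The first term has no kink, so the kinks of the
    other two agree on every real line.\<close>
  have "weight ((b2 + p * a21 + q * a22) - cnj (b1 + p * a11 + q * a12))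
      * norm ((u * a21 + v * a22) - cnj (u * a11 + v * a12)) = weight (q - cnj p) * norm (v - cnj u)"
    for p q u v
  proof -
    let ?h = "\<lambda>t. ln (norm (h (p + of_real t * u) (q + of_real t * v)))"
    have "kink (\<lambda>t. ?h t + phi (P p q + of_real t * (u * a11 + v * a12)) (Q p q + of_real t * (u * a21 + v * a22)))
        (0 + 2 * weight (Q p q - cnj (P p q)) * norm ((u * a21 + v * a22) - cnj (u * a11 + v * a12)))"
      by (rule kink_add[OF kink_ln_norm[OF hh nz] kink_phi])
    moreover have "?h t + phi (P p q + of_real t * (u * a11 + v * a12)) (Q p q + of_real t * (u * a21 + v * a22))
        = phi (p + of_real t * u) (q + of_real t * v)" for t
    proof -
      let ?p = "p + of_real t * u" and ?q = "q + of_real t * v"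
      have "ln (norm (h ?p ?q) * exp (phi (P ?p ?q) (Q ?p ?q))) = phi ?p ?q"
        unfolding bal by simp
      then have "?h t + phi (P ?p ?q) (Q ?p ?q) = phi ?p ?q"
        using nz by (simp add: ln_mult)
      moreover have "P ?p ?q = P p q + of_real t * (u * a11 + v * a12)"
        "Q ?p ?q = Q p q + of_real t * (u * a21 + v * a22)"
        unfolding P Q by (simp_all add: algebra_simps)
      ultimately show ?thesis by simp
    qed
    ultimately have "kink (\<lambda>t. phi (p + of_real t * u) (q + of_real t * v))
        (2 * weight (Q p q - cnj (P p q)) * norm ((u * a21 + v * a22) - cnj (u * a11 + v * a12)))"
      by simp
    from kink_unique[OF this kink_phi] show ?thesis unfolding P Q by simp
  qed
  note a = weight_rigidity[OF this]
  have P': "P p q = p + b1" and Q': "Q p q = q + cnj b1" for p q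
    unfolding P Q using a by simp_all
  \<comment> \<open>The exponential cancels the modulus of \<open>h\<close>: the real part of its
    exponent is the change of \<open>phi\<close> under the translation. Hence \<open>k\<close> is
    entire on complex lines with modulus 1, and Liouville makes it the constant
    \<open>c\<close>.\<close>
  define k where "k = (\<lambda>p q. h p q * exp (of_real pi * cnj b1 * p + of_real (pi / 2 * (norm b1)\<^sup>2)))"
  have k1: "norm (k p q) = 1" for p q
  proof -
    have "phi (p + b1) (q + cnj b1) = phi p q + Re (of_real pi * cnj b1 * p + of_real (pi / 2 * (norm b1)\<^sup>2))"
      unfolding phi_def cmod_power2 by (simp add: power2_eq_square algebra_simps)
    then have "norm (h p q) * (exp (phi p q) * exp (Re (of_real pi * cnj b1 * p + of_real (pi / 2 * (norm b1)\<^sup>2))))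
        = exp (phi p q)"
      using bal[of p q] unfolding P' Q' by (simp only: exp_add)
    then have "(norm (h p q) * exp (Re (of_real pi * cnj b1 * p + of_real (pi / 2 * (norm b1)\<^sup>2)))) * exp (phi p q)
        = 1 * exp (phi p q)"
      by (simp only: mult_ac mult_1)
    then show ?thesis unfolding k_def norm_mult norm_exp_eq_Re by (subst (asm) mult_cancel_right) auto
  qed
  have k: "k p q = k 0 0" for p q
  proof -
    have "(\<lambda>\<zeta>. k (0 + \<zeta> * p) (0 + \<zeta> * q)) holomorphic_on UNIV"
      unfolding k_def by (intro holomorphic_intros hh)
    moreover have "bounded (range (\<lambda>\<zeta>. k (0 + \<zeta> * p) (0 + \<zeta> * q)))"
      using k1 by (auto simp: bounded_iff)
    ultimately have "(\<lambda>\<zeta>. k (0 + \<zeta> * p) (0 + \<zeta> * q)) constant_on UNIV" by (rule Liouville_theorem)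
    then obtain y where "\<And>\<zeta>. k (0 + \<zeta> * p) (0 + \<zeta> * q) = y" unfolding constant_on_def by blast
    from this[of 1] this[of 0] show ?thesis by simp
  qed
  have h: "h p q = k 0 0 * exp (- (of_real pi * cnj b1 * p + of_real (pi / 2 * (norm b1)\<^sup>2)))" for p q
  proof -
    have "h p q = k p q * exp (- (of_real pi * cnj b1 * p + of_real (pi / 2 * (norm b1)\<^sup>2)))"
      unfolding k_def by (simp add: mult.assoc flip: exp_add)
    then show ?thesis by (simp only: k[of p q])
  qed
  show thesis
  proof (rule that[of "k 0 0" b1])
    fix p q z :: complex assume "vector [p, q, z] \<in> heis_domain"
    from F[OF this] show "f (vector [p, q, z]) = vector [p + b1, q + cnj b1,
        z * (k 0 0 * exp (- (of_real pi * cnj b1 * p + of_real (pi / 2 * (norm b1)\<^sup>2))))]"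
      unfolding P' Q' h[of p q] .
  qed (rule k1)
qed

subsection \<open>Bounded type and the group action\<close>

lemma continuous_on_vector3 [continuous_intros]:
  fixes f g h :: "'a::topological_space \<Rightarrow> 'b::{topological_space, zero}"
  assumes "continuous_on S f" "continuous_on S g" "continuous_on S h"
  shows "continuous_on S (\<lambda>x. vector [f x, g x, h x] :: 'b ^ 3)"
proof -
  have "\<forall>i. ((\<lambda>x. (vector [f x, g x, h x] :: 'b ^ 3) $ i)
      \<longlongrightarrow> (vector [f x, g x, h x] :: 'b ^ 3) $ i) (at x within S)" if "x \<in> S" for x
    unfolding forall_3 using assms that by (simp add: continuous_on_def)
  then show ?thesis unfolding continuous_on_def by (simp add: vec_tendstoI)
qed

lemma biholomorphic_mapI:
  assumes "f ` D \<subseteq> E" "g ` E \<subseteq> D" "\<And>x. x \<in> D \<Longrightarrow> g (f x) = x" "\<And>y. y \<in> E \<Longrightarrow> f (g y) = y"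
    and "holomorphic_map_on f D" "holomorphic_map_on g E"
  shows "biholomorphic_map D E f"
proof -
  have b: "bij_betw f D E" by (rule bij_betw_byWitness[where f' = g]) (use assms in auto)
  have "inv_into D f y = g y" if "y \<in> E" for y
    using that assms b by (metis bij_betw_imp_inj_on image_subset_iff inv_into_f_eq)
  then have "holomorphic_map_on (inv_into D f) E"
    using assms(6) holomorphic_map_on_cong[of E "inv_into D f" g] by simp
  then show ?thesis using b assms(5) by (simp add: biholomorphic_map_def)
qed

text \<open>Evaluation at this point determines \<open>a\<close>, \<open>b\<close>, and
  \<open>c\<close> modulo the integers; both the kernel and openness of the isomorphism are read off
  here.\<close>

definition base_point :: "complex ^ 3" where
  "base_point = vector [0, 0, of_real (exp (- phi 0 0) / 2)]"

lemma base_point_in: "base_point \<in> heis_domain"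
  using half_exp[of "phi 0 0"] by (simp add: base_point_def del: of_real_divide)

text \<open>The domain is the continuous, not holomorphic, image of the convex half-space
  \<open>Re (w $ 3) < 0\<close>: the exponential wraps a half-plane around each punctured disc, and
  subtracting \<open>phi\<close> adjusts the radius.\<close>

lemma complex_domain_heis_domain: "complex_domain heis_domain"
  unfolding complex_domain_def
proof (intro conjI open_heis_domain)
  show "heis_domain \<noteq> {}" using base_point_in by blast
  let ?T = "{w :: complex ^ 3. Re (w $ 3) < 0}"
  let ?e = "\<lambda>w. vector [w $ 1, w $ 2, exp (w $ 3 - phi (w $ 1) (w $ 2))] :: complex ^ 3"
  have img: "heis_domain = ?e ` ?T"
  proof (intro equalityI subsetI)
    fix x assume x: "x \<in> heis_domain"
    let ?w = "vector [x $ 1, x $ 2, Ln (x $ 3) + phi (x $ 1) (x $ 2)] :: complex ^ 3"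
    have nz: "x $ 3 \<noteq> 0" and lt: "norm (x $ 3) * exp (phi (x $ 1) (x $ 2)) < 1"
      using x by (auto simp: heis_domain_def)
    have "ln (norm (x $ 3) * exp (phi (x $ 1) (x $ 2))) < 0" using lt nz by (simp add: ln_less_zero)
    then have "?w \<in> ?T" using nz by (simp add: ln_mult Re_Ln)
    moreover have "x = ?e ?w" using nz by (simp add: vector3_eta)
    ultimately show "x \<in> ?e ` ?T" by blast
  next
    fix x assume "x \<in> ?e ` ?T"
    then show "x \<in> heis_domain" by (auto simp flip: exp_add)
  qed
  have conv: "convex ?T"
  proof (rule convexI)
    fix x y :: "complex ^ 3" and u v :: real
    assume "x \<in> ?T" "y \<in> ?T" "0 \<le> u" "0 \<le> v" "u + v = 1"
    then show "u *\<^sub>R x + v *\<^sub>R y \<in> ?T"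
      using convex_bound_lt[of "Re (x $ 3)" 0 "Re (y $ 3)" u v] by simp
  qed
  have cont: "continuous_on ?T ?e" by (intro continuous_intros)
  show "connected heis_domain"
    unfolding img by (rule connected_continuous_image[OF cont convex_connected[OF conv]])
qed

text \<open>The factor \<open>exp (phi p q)\<close> dominates \<open>norm p\<close>,
  \<open>norm q\<close> and 1, so after multiplication by \<open>z\<close> each coordinate has
  modulus at most 1. Nonvanishing of \<open>z\<close> makes this multiplication invertible.\<close>

lemma bounded_type_heis_domain: "domain_of_bounded_type heis_domain"
proof -
  define \<Theta> :: "complex ^ 3 \<Rightarrow> complex ^ 3" where
    "\<Theta> = (\<lambda>x. vector [x $ 1 * x $ 3, x $ 2 * x $ 3, x $ 3])"
  define \<Theta>' :: "complex ^ 3 \<Rightarrow> complex ^ 3" where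
    "\<Theta>' = (\<lambda>y. vector [y $ 1 * inverse (y $ 3), y $ 2 * inverse (y $ 3), y $ 3])"
  define E where "E = {y. y $ 3 \<noteq> 0} \<inter> \<Theta>' -` heis_domain"
  have nz: "x $ 3 \<noteq> 0" if "x \<in> heis_domain" for x using that by (simp add: heis_domain_def)
  have inv1: "\<Theta>' (\<Theta> x) = x" if "x $ 3 \<noteq> 0" for x
    using that by (simp add: \<Theta>_def \<Theta>'_def vector3_eta mult.assoc)
  have inv2: "\<Theta> (\<Theta>' y) = y" if "y $ 3 \<noteq> 0" for y
    using that by (simp add: \<Theta>_def \<Theta>'_def vector3_eta mult.assoc)
  have \<Theta>D: "\<Theta> x \<in> E" if "x \<in> heis_domain" for x
    using inv1[OF nz[OF that]] nz[OF that] that by (simp add: E_def) (simp add: \<Theta>_def)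
  have E: "E = \<Theta> ` heis_domain"
    using \<Theta>D inv2 by (force simp: E_def)
  have "holomorphic_map_on \<Theta> heis_domain"
    unfolding \<Theta>_def
    by (intro holomorphic_map_on_vector3 holomorphic_fun_on_mult holomorphic_fun_on_nth)
  moreover have "holomorphic_map_on \<Theta>' E"
    unfolding \<Theta>'_def
    by (intro holomorphic_map_on_vector3 holomorphic_fun_on_mult holomorphic_fun_on_nth
        holomorphic_fun_on_inverse) (auto simp: E_def)
  ultimately have "biholomorphic_map heis_domain E \<Theta>"
    by (intro biholomorphic_mapI[where g = \<Theta>']) (use \<Theta>D inv1 inv2 nz in \<open>auto simp: E_def\<close>)
  moreover have "complex_domain E"
    unfolding complex_domain_def
  proof (intro conjI)
    have "open {y :: complex ^ 3. y $ 3 \<noteq> 0}" by (intro open_Collect_neq continuous_intros)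
    then show "open E"
      unfolding E_def \<Theta>'_def
      by (intro continuous_open_preimage open_heis_domain) (auto intro!: continuous_intros)
    show "connected E"
      using connected_continuous_image[of heis_domain \<Theta>] complex_domain_heis_domain
      unfolding E complex_domain_def \<Theta>_def by (simp add: continuous_intros)
    show "E \<noteq> {}" using \<Theta>D[OF base_point_in] by blast
  qed
  moreover have "bounded E"
    unfolding bounded_iff
  proof (intro exI[of _ 3] ballI)
    fix y assume "y \<in> E"
    then obtain x where x: "x \<in> heis_domain" and y: "y = \<Theta> x" unfolding E by blast
    let ?p = "x $ 1" and ?q = "x $ 2" and ?z = "x $ 3"
    have lt: "norm ?z * exp (phi ?p ?q) < 1" using x by (simp add: heis_domain_def)
    have ex: "1 + phi ?p ?q \<le> exp (phi ?p ?q)" by (rule exp_ge_add_one_self)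
    have "2 * norm ?p \<le> 1 + (norm ?p)\<^sup>2"
      using zero_le_power2[of "norm ?p - 1"] by (simp add: power2_eq_square algebra_simps)
    then have p: "norm ?p \<le> exp (phi ?p ?q)"
      using ex phi_ge_norm_p[of ?p ?q] norm_ge_zero[of ?p] by linarith
    have "2 * norm ?q \<le> 1 + (norm ?q)\<^sup>2"
      using zero_le_power2[of "norm ?q - 1"] by (simp add: power2_eq_square algebra_simps)
    then have q: "norm ?q \<le> exp (phi ?p ?q)"
      using ex phi_ge_norm_q[of ?q ?p] phi_nonneg[of ?p ?q] by linarith
    have bnd: "norm ?z * t \<le> 1" if "t \<le> exp (phi ?p ?q)" for t
      using mult_left_mono[OF that, of "norm ?z"] lt by simp
    have "norm y \<le> (\<Sum>i\<in>UNIV. norm (y $ i))"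
      unfolding norm_vec_def by (rule L2_set_le_sum) simp
    also have "\<dots> = norm ?z * norm ?p + norm ?z * norm ?q + norm ?z * 1"
      by (simp add: sum_3 y \<Theta>_def norm_mult)
    also have "\<dots> \<le> 3" using bnd[OF p] bnd[OF q] bnd[of 1] ex phi_nonneg[of ?p ?q] by linarith
    finally show "norm y \<le> 3" .
  qed
  ultimately show ?thesis
    unfolding domain_of_bounded_type_def using complex_domain_heis_domain by blast
qed

text \<open>The translations by \<open>(w, cnj w)\<close> alone compose with the antisymmetric cocycle \<open>pi * (a * b' - a' * b)\<close>;
  the phase \<open>- pi * a * b\<close> turns it into the cocycle \<open>2 * pi * a * b'\<close> of the matrix product.\<close>

definition act :: "real \<Rightarrow> real \<Rightarrow> real \<Rightarrow> complex ^ 3 \<Rightarrow> complex ^ 3" where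
  "act a b c x = vector [x $ 1 + Complex a (- b), x $ 2 + Complex a b,
     x $ 3 * exp (2 * pi * c * \<i> - pi * a * b * \<i> - (pi * Complex a b * x $ 1 + pi / 2 * (a\<^sup>2 + b\<^sup>2)))]"

text \<open>The cross term \<open>- pi * Complex a b * Complex a' (- b')\<close> completes the
  squares with its real part. Its imaginary part \<open>pi * (a * b' - a' * b)\<close> and the mixed
  terms of \<open>pi * (a + a') * (b + b')\<close> add up to \<open>2 * pi * a * b'\<close>.\<close>

lemma act_act: "act a b c (act a' b' c' x) = act (a + a') (b + b') (c + c' + a * b') x"
proof -
  have "exp (2 * pi * c' * \<i> - pi * a' * b' * \<i> - (pi * Complex a' b' * p + pi / 2 * (a'\<^sup>2 + b'\<^sup>2)))
    * exp (2 * pi * c * \<i> - pi * a * b * \<i> - (pi * Complex a b * (p + Complex a' (- b')) + pi / 2 * (a\<^sup>2 + b\<^sup>2)))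
    = exp (2 * pi * (c + c' + a * b') * \<i> - pi * (a + a') * (b + b') * \<i>
      - (pi * Complex (a + a') (b + b') * p + pi / 2 * ((a + a')\<^sup>2 + (b + b')\<^sup>2)))" for p
    unfolding exp_add[symmetric]
    by (rule arg_cong[of _ _ exp]) (simp add: complex_eq_iff power2_eq_square algebra_simps add_divide_distrib)
  then show ?thesis
    unfolding act_def vector3_eq_iff by (simp add: complex_eq_iff mult.assoc)
qed

lemma act_0: "act 0 0 0 x = x"
  by (simp add: act_def vector3_eta flip: complex_of_real_def zero_complex.code)

lemma act_shift_int: "act a b (c + of_int n) x = act a b c x"
proof -
  have "exp (2 * pi * (c + of_int n) * \<i> - s) = exp (2 * pi * c * \<i> - s)" for s
    by (subst exp_eq) (auto intro!: exI[of _ n] simp: algebra_simps)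
  then show ?thesis unfolding act_def diff_diff_eq by simp
qed

text \<open>The translation changes \<open>phi\<close> by exactly minus the real part of the
  exponent, so the action preserves \<open>rho\<close>.\<close>

lemma act_mem: "x \<in> heis_domain \<Longrightarrow> act a b c x \<in> heis_domain"
proof -
  assume x: "x \<in> heis_domain"
  let ?p = "x $ 1" and ?q = "x $ 2"
  let ?E = "2 * pi * c * \<i> - pi * a * b * \<i> - (pi * Complex a b * ?p + pi / 2 * (a\<^sup>2 + b\<^sup>2))"
  have "phi (?p + Complex a (- b)) (?q + Complex a b) = phi ?p ?q - Re ?E"
  proof -
    have "(?q + Complex a b) - cnj (?p + Complex a (- b)) = ?q - cnj ?p"
      by (simp add: complex_eq_iff)
    then show ?thesis unfolding phi_def cmod_power2
      by (simp add: power2_eq_square algebra_simps add_divide_distrib)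
  qed
  then have "norm (x $ 3 * exp ?E) * exp (phi (?p + Complex a (- b)) (?q + Complex a b))
      = norm (x $ 3) * exp (phi ?p ?q)"
    by (simp only: norm_mult norm_exp_eq_Re mult.assoc exp_add[symmetric]) simp
  then show ?thesis using x unfolding act_def vector3_in_heis_domain by (simp add: heis_domain_def)
qed

lemma act_biholomorphic: "biholomorphic_map heis_domain heis_domain (act a b c)"
proof (rule biholomorphic_mapI[where g = "act (- a) (- b) (a * b - c)"])
  have "holomorphic_map_on (act a b c) heis_domain" for a b c
    unfolding act_def
  proof (intro holomorphic_map_on_vector3 holomorphic_fun_on_mult holomorphic_fun_on_add
        holomorphic_fun_on_nth holomorphic_fun_on_const)
    show "holomorphic_fun_on (\<lambda>x. exp (2 * pi * c * \<i> - pi * a * b * \<i>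
        - (pi * Complex a b * x $ 1 + pi / 2 * (a\<^sup>2 + b\<^sup>2)))) heis_domain"
      by (rule holomorphic_fun_on_compose[OF holomorphic_fun_on_nth, where T = UNIV and
            g = "\<lambda>p. exp (2 * pi * c * \<i> - pi * a * b * \<i> - (pi * Complex a b * p + pi / 2 * (a\<^sup>2 + b\<^sup>2)))"])
        (auto intro!: holomorphic_intros)
  qed
  then show "holomorphic_map_on (act a b c) heis_domain"
    "holomorphic_map_on (act (- a) (- b) (a * b - c)) heis_domain" by blast+
qed (auto simp: act_mem act_act act_0)

lemma continuous_on_act:
  "continuous_on S f \<Longrightarrow> continuous_on S g \<Longrightarrow> continuous_on S h \<Longrightarrow> continuous_on S k
    \<Longrightarrow> continuous_on S (\<lambda>x. act (f x) (g x) (h x) (k x))"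
  unfolding act_def complex_eq by (intro continuous_intros) auto

subsection \<open>The isomorphism of topological groups\<close>

text \<open>Reading entries of an arbitrary matrix makes this a family over the whole matrix space,
  where joint continuity can be used with open sets.\<close>

definition aut_of :: "real ^ 3 ^ 3 \<Rightarrow> complex ^ 3 \<Rightarrow> complex ^ 3" where
  "aut_of A = restrict (act (A $ 1 $ 2) (A $ 2 $ 3) (A $ 1 $ 3)) heis_domain"

lemma heisenberg_matrix_nth [simp]:
  "heisenberg_matrix a b c $ 1 $ 2 = a" "heisenberg_matrix a b c $ 2 $ 3 = b"
  "heisenberg_matrix a b c $ 1 $ 3 = c"
  by (simp_all add: heisenberg_matrix_def)

lemma aut_of_heisenberg_matrix: "aut_of (heisenberg_matrix a b c) = restrict (act a b c) heis_domain"
  by (simp add: aut_of_def)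

lemma aut_of_in_carrier: "aut_of A \<in> carrier (aut_group heis_domain)"
proof -
  let ?g = "act (A $ 1 $ 2) (A $ 2 $ 3) (A $ 1 $ 3)"
  have b: "biholomorphic_map heis_domain heis_domain ?g" by (rule act_biholomorphic)
  have "bij_betw (aut_of A) heis_domain heis_domain"
    using b bij_betw_cong[of heis_domain "aut_of A" ?g] by (simp add: aut_of_def biholomorphic_map_def)
  moreover have "holomorphic_map_on (aut_of A) heis_domain"
    using b holomorphic_map_on_cong[of heis_domain "aut_of A" ?g]
    by (simp add: aut_of_def biholomorphic_map_def)
  moreover have "inv_into heis_domain (aut_of A) = inv_into heis_domain ?g"
    unfolding aut_of_def inv_into_def by (rule ext, rule arg_cong[of _ _ Eps]) auto
  ultimately show ?thesis
    using b by (simp add: aut_group_def biholomorphic_map_def) (simp add: aut_of_def)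
qed

lemma group_hom_aut_of: "group_hom heisenberg_group (aut_group heis_domain) aut_of"
proof (intro group_hom.intro group_heisenberg_group group_aut_group group_hom_axioms.intro homI)
  show "aut_of A \<in> carrier (aut_group heis_domain)" for A by (rule aut_of_in_carrier)
  fix A B assume "A \<in> carrier heisenberg_group" "B \<in> carrier heisenberg_group"
  then obtain a b c a' b' c' where A: "A = heisenberg_matrix a b c" and B: "B = heisenberg_matrix a' b' c'"
    by (auto simp: heisenberg_group_def)
  have "aut_of M \<in> Bij heis_domain" for M
    using aut_of_in_carrier[of M] by (simp add: aut_group_def Bij_def biholomorphic_map_def)
  then have "aut_of A \<otimes>\<^bsub>aut_group heis_domain\<^esub> aut_of B = compose heis_domain (aut_of A) (aut_of B)"
    by (simp add: aut_group_def BijGroup_def)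
  also have "\<dots> = aut_of (A ** B)"
    unfolding A B heisenberg_matrix_mult aut_of_heisenberg_matrix
    by (auto simp: compose_def act_act act_mem intro!: restrict_ext)
  finally show "aut_of (A \<otimes>\<^bsub>heisenberg_group\<^esub> B) = aut_of A \<otimes>\<^bsub>aut_group heis_domain\<^esub> aut_of B"
    by (simp add: heisenberg_group_def)
qed

lemma act_base_point:
  "act a b c base_point = vector [Complex a (- b), Complex a b,
    of_real (exp (- phi 0 0) / 2) * exp (2 * pi * c * \<i> - pi * a * b * \<i> - pi / 2 * (a\<^sup>2 + b\<^sup>2))]"
  by (simp add: act_def base_point_def)

lemma kernel_aut_of:
  "kernel heisenberg_group (aut_group heis_domain) aut_of = heisenberg_subgroup"
proof (intro equalityI subsetI)
  fix A assume "A \<in> kernel heisenberg_group (aut_group heis_domain) aut_of"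
  then obtain a b c where A: "A = heisenberg_matrix a b c"
    and one: "aut_of A = (\<lambda>x\<in>heis_domain. x)"
    by (auto simp: kernel_def heisenberg_group_def aut_group_def BijGroup_def)
  have "act a b c base_point = base_point"
    using fun_cong[OF one, of base_point] base_point_in by (simp add: A aut_of_heisenberg_matrix)
  then have "Complex a b = 0" and e: "exp (2 * pi * c * \<i> - pi * a * b * \<i> - pi / 2 * (a\<^sup>2 + b\<^sup>2)) = 1"
    unfolding act_base_point unfolding base_point_def vector3_eq_iff by auto
  then have ab: "a = 0" "b = 0" by (simp_all add: complex_eq_iff)
  then obtain n :: int where "2 * pi * c = of_int (2 * n) * pi"
    using e by (auto simp: exp_eq_1)
  then have "c = of_int n" by simp
  then show "A \<in> heisenberg_subgroup" using ab by (auto simp: A heisenberg_subgroup_def)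
next
  fix A assume "A \<in> heisenberg_subgroup"
  then obtain n :: int where A: "A = heisenberg_matrix 0 0 (of_int n)"
    by (auto simp: heisenberg_subgroup_def elim: Ints_cases)
  have "aut_of A = (\<lambda>x\<in>heis_domain. x)"
    unfolding A aut_of_heisenberg_matrix
    using act_shift_int[of 0 0 0 n] by (intro restrict_ext) (simp add: act_0)
  then show "A \<in> kernel heisenberg_group (aut_group heis_domain) aut_of"
    by (auto simp: A kernel_def heisenberg_group_def aut_group_def BijGroup_def)
qed

lemma aut_of_surj: "aut_of ` carrier heisenberg_group = carrier (aut_group heis_domain)"
proof (intro equalityI subsetI)
  fix f assume "f \<in> carrier (aut_group heis_domain)"
  then have ext: "f \<in> extensional heis_domain" and f: "biholomorphic_map heis_domain heis_domain f"
    by (auto simp: aut_group_def)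
  obtain w c where c: "norm c = 1" and F: "\<And>p q z. vector [p, q, z] \<in> heis_domain \<Longrightarrow> f (vector [p, q, z])
      = vector [p + w, q + cnj w, z * (c * exp (- (of_real pi * cnj w * p + of_real (pi / 2 * (norm w)\<^sup>2))))]"
    by (rule automorphism_form[OF f]) blast
  define a b where "a = Re w" "b = - Im w"
  have w: "w = Complex a (- b)" "cnj w = Complex a b" by (simp_all add: a_b_def complex_eq_iff)
  obtain \<theta> where \<theta>: "c = exp (\<i> * of_real \<theta>)" using c by (metis complex_norm_eq_1_exp)
  \<comment> \<open>Solves \<open>\<theta> = 2 * pi * s - pi * a * b\<close>, undoing the phase
    correction built into \<open>act\<close>.\<close>
  define s where "s = (\<theta> + pi * a * b) / (2 * pi)"
  have s: "pi * (s * 2) = \<theta> + pi * (a * b)" by (simp add: s_def)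
  have nw: "(norm w)\<^sup>2 = a\<^sup>2 + b\<^sup>2" by (simp add: a_b_def cmod_power2)
  have "f x = act a b s x" if x: "x \<in> heis_domain" for x
  proof -
    have "c * exp (- (of_real pi * cnj w * x $ 1 + of_real (pi / 2 * (norm w)\<^sup>2)))
        = exp (2 * pi * s * \<i> - pi * a * b * \<i> - (pi * Complex a b * x $ 1 + pi / 2 * (a\<^sup>2 + b\<^sup>2)))"
      unfolding \<theta> nw w(2) exp_add[symmetric]
      by (rule arg_cong[of _ _ exp]) (simp add: complex_eq_iff s algebra_simps)
    moreover have "f x = vector [x $ 1 + w, x $ 2 + cnj w, x $ 3 *
        (c * exp (- (of_real pi * cnj w * x $ 1 + of_real (pi / 2 * (norm w)\<^sup>2))))]"
      using F[of "x $ 1" "x $ 2" "x $ 3"] x by (simp only: vector3_eta)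
    ultimately show ?thesis unfolding act_def by (simp only: w[symmetric])
  qed
  then have "f = aut_of (heisenberg_matrix a b s)"
    unfolding aut_of_heisenberg_matrix using ext by (intro extensionalityI) auto
  then show "f \<in> aut_of ` carrier heisenberg_group" by (auto simp: heisenberg_group_def)
qed (use aut_of_in_carrier in blast)

definition aut_iso :: "(real ^ 3 ^ 3) set \<Rightarrow> complex ^ 3 \<Rightarrow> complex ^ 3" where
  "aut_iso X = the_elem (aut_of ` X)"

lemma aut_iso_in_iso: "aut_iso \<in> iso G_group (aut_group heis_domain)"
  using group_hom.FactGroup_iso_set[OF group_hom_aut_of aut_of_surj]
  unfolding kernel_aut_of G_group_def aut_iso_def[abs_def] .

lemma aut_iso_coset:
  assumes A: "A \<in> carrier heisenberg_group"
  shows "aut_iso (heisenberg_subgroup #>\<^bsub>heisenberg_group\<^esub> A) = aut_of A"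
proof -
  interpret group_hom heisenberg_group "aut_group heis_domain" aut_of by (rule group_hom_aut_of)
  have "aut_of (h \<otimes>\<^bsub>heisenberg_group\<^esub> A) = aut_of A" if "h \<in> heisenberg_subgroup" for h
    using that A unfolding kernel_aut_of[symmetric] kernel_def by simp
  moreover have "\<one>\<^bsub>heisenberg_group\<^esub> \<in> heisenberg_subgroup"
    unfolding kernel_aut_of[symmetric] kernel_def by simp
  ultimately have "aut_of ` (heisenberg_subgroup #>\<^bsub>heisenberg_group\<^esub> A) = {aut_of A}"
    unfolding r_coset_def using A by (force simp: image_UN)
  then show ?thesis by (simp add: aut_iso_def)
qed

section \<open>Continuity and openness of the isomorphism\<close>

text \<open>\<open>act\<close> is jointly continuous in matrix and point, so by the tube lemma the
  condition of mapping a compact \<open>K\<close> into \<open>U\<close> is open in the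
  matrix.\<close>

lemma continuous_map_aut_of:
  "continuous_map (top_of_set (carrier heisenberg_group)) (aut_topology heis_domain) aut_of"
  unfolding aut_topology_def continuous_on_generated_topo_iff
proof (intro conjI allI impI)
  let ?C = "carrier heisenberg_group"
  fix V assume "V \<in> {{f \<in> carrier (aut_group heis_domain). f ` K \<subseteq> U} |K U.
      compact K \<and> K \<subseteq> heis_domain \<and> open U}"
  then obtain K U where V: "V = {f \<in> carrier (aut_group heis_domain). f ` K \<subseteq> U}"
    and K: "compact K" "K \<subseteq> heis_domain" and U: "open U" by blast
  define W where "W = (\<lambda>(A :: real ^ 3 ^ 3, x). act (A $ 1 $ 2) (A $ 2 $ 3) (A $ 1 $ 3) x) -` U"
  have "open W"
    unfolding W_def case_prod_unfold
    by (intro open_vimage U continuous_on_act continuous_intros)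
  define S where "S = {A :: real ^ 3 ^ 3. {A} \<times> K \<subseteq> W}"
  have "open S"
  proof (subst open_subopen, intro ballI)
    fix A assume "A \<in> S"
    then have "{A} \<times> K \<subseteq> W" by (simp add: S_def)
    from Elementary_Topology.tube_lemma[OF K(1) \<open>open W\<close> this] obtain X where "A \<in> X" "open X" "X \<times> K \<subseteq> W" by blast
    then show "\<exists>T. open T \<and> A \<in> T \<and> T \<subseteq> S" by (intro exI[of _ X]) (auto simp: S_def)
  qed
  moreover have "aut_of A ` K = act (A $ 1 $ 2) (A $ 2 $ 3) (A $ 1 $ 3) ` K" for A
    using K(2) by (intro image_cong) (auto simp: aut_of_def)
  then have "aut_of -` V \<inter> topspace (top_of_set ?C) = ?C \<inter> S"
    using aut_of_in_carrier by (auto simp: V S_def W_def)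
  ultimately show "openin (top_of_set ?C) (aut_of -` V \<inter> topspace (top_of_set ?C))"
    by (simp add: openin_open_Int)
next
  show "aut_of ` topspace (top_of_set (carrier heisenberg_group))
      \<subseteq> \<Union> {{f \<in> carrier (aut_group heis_domain). f ` K \<subseteq> U} |K U.
        compact K \<and> K \<subseteq> heis_domain \<and> open U}"
    using topspace_aut_topology[of heis_domain] aut_of_in_carrier
    unfolding aut_topology_def topology_generated_by_topspace by blast
qed

lemma continuous_on_heisenberg_matrix:
  "continuous_on S (\<lambda>(a, b, c). heisenberg_matrix a b c)"
  unfolding heisenberg_matrix_def case_prod_unfold by (intro continuous_intros)

text \<open>The phase knows \<open>c - c0\<close> only modulo the integers. The principal logarithm
  selects a representative \<open>c + of_int n\<close>, and its small imaginary part bounds the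
  distance to \<open>c0\<close>.\<close>

lemma phase_close:
  assumes "0 < \<epsilon>" and V: "exp (2 * pi * of_real (c - c0) * \<i>) \<in> {w. 0 < Re w} \<inter> Ln -` {l. \<bar>Im l\<bar> < 2 * pi * \<epsilon>}"
  obtains n :: int where "\<bar>c + of_int n - c0\<bar> < \<epsilon>"
proof -
  let ?w = "exp (2 * pi * of_real (c - c0) * \<i>) :: complex"
  have "exp (Ln ?w) = exp (2 * pi * of_real (c - c0) * \<i>)" by simp
  then obtain n :: int where n: "Ln ?w = 2 * pi * of_real (c - c0) * \<i> + of_int (2 * n) * pi * \<i>"
    unfolding exp_eq by blast
  have "Im (Ln ?w) = Im (2 * pi * of_real (c - c0) * \<i> + of_int (2 * n) * pi * \<i>)"
    by (simp only: n)
  also have "\<dots> = 2 * pi * (c + of_int n - c0)" by (simp add: algebra_simps)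
  finally have "Im (Ln ?w) = 2 * pi * (c + of_int n - c0)" .
  then have "\<bar>2 * pi * (c + of_int n - c0)\<bar> < 2 * pi * \<epsilon>" using V by simp
  then have "2 * pi * \<bar>c + of_int n - c0\<bar> < 2 * pi * \<epsilon>" by (simp add: abs_mult)
  then show thesis using that[of n] by simp
qed

text \<open>Subbasic sets for the one-point compact set \<open>{base_point}\<close> are fine enough:
  an automorphism that moves this point almost as \<open>f\<close> does has parameters close to
  those of \<open>f\<close>, after an integer change of \<open>c\<close> that stays in the same
  coset.\<close>

lemma open_map_aut_iso: "open_map G_topology (aut_topology heis_domain) aut_iso"
  unfolding open_map_def
proof (intro allI impI)
  fix O' assume O': "openin G_topology O'"
  let ?C = "carrier heisenberg_group" and ?q = "\<lambda>A. heisenberg_subgroup #>\<^bsub>heisenberg_group\<^esub> A"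
  have sub: "O' \<subseteq> ?q ` ?C" and "openin (top_of_set ?C) {A \<in> ?C. ?q A \<in> O'}"
    using O' unfolding G_topology_def openin_quotient_topology by auto
  then obtain T where T: "open T" "{A \<in> ?C. ?q A \<in> O'} = ?C \<inter> T"
    unfolding openin_open by blast
  have m: "heisenberg_matrix a b c \<in> ?C" for a b c by (auto simp: heisenberg_group_def)
  show "openin (aut_topology heis_domain) (aut_iso ` O')"
  proof (subst openin_subopen, intro ballI)
    fix f assume "f \<in> aut_iso ` O'"
    then obtain A0 where A0: "A0 \<in> ?C" "?q A0 \<in> O'" "f = aut_iso (?q A0)" using sub by blast
    moreover from A0(1) obtain a0 b0 c0 where "A0 = heisenberg_matrix a0 b0 c0"
      by (auto simp: heisenberg_group_def)
    ultimately have 0: "?q (heisenberg_matrix a0 b0 c0) \<in> O'"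
      and f: "f = aut_of (heisenberg_matrix a0 b0 c0)"
      using aut_iso_coset by auto
    let ?M = "\<lambda>(a, b, c). heisenberg_matrix a b c"
    have "open (?M -` T)" by (rule open_vimage[OF T(1) continuous_on_heisenberg_matrix])
    moreover have "(a0, b0, c0) \<in> ?M -` T" using 0 m T(2) by auto
    ultimately obtain d where d: "0 < d" "ball (a0, b0, c0) d \<subseteq> ?M -` T"
      unfolding open_contains_ball by blast
    \<comment> \<open>A third of \<open>d\<close> for each of the three parameters.\<close>
    define \<epsilon> where "\<epsilon> = d / 3"
    have "0 < \<epsilon>" using d(1) by (simp add: \<epsilon>_def)
    have near: "?q (heisenberg_matrix a b c) \<in> O'"
      if "\<bar>a - a0\<bar> < \<epsilon>" "\<bar>b - b0\<bar> < \<epsilon>" "\<bar>c - c0\<bar> < \<epsilon>" for a b c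
    proof -
      have "dist (a0, b0, c0) (a, b, c) \<le> dist a0 a + dist (b0, c0) (b, c)"
        unfolding dist_Pair_Pair[of a0] by (rule sqrt_sum_squares_le_sum) auto
      also have "dist (b0, c0) (b, c) \<le> dist b0 b + dist c0 c"
        unfolding dist_Pair_Pair by (rule sqrt_sum_squares_le_sum) auto
      finally have "dist (a0, b0, c0) (a, b, c) \<le> dist a0 a + (dist b0 b + dist c0 c)" by simp
      then have "(a, b, c) \<in> ball (a0, b0, c0) d"
        using that by (simp add: \<epsilon>_def dist_real_def abs_minus_commute)
      then have "heisenberg_matrix a b c \<in> T" using d(2) by auto
      then show ?thesis using m T(2) by blast
    qed
    define z0 where "z0 = complex_of_real (exp (- phi 0 0) / 2)"
    have z0: "z0 \<noteq> 0" by (simp add: z0_def)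
    \<comment> \<open>For \<open>y\<close> in the orbit of the base point,
      \<open>a = Re (y $ 1)\<close> and \<open>b = - Im (y $ 1)\<close>. Dividing out every factor
      of \<open>y $ 3\<close> that depends on them, as well as \<open>z0\<close> and the phase of
      \<open>c0\<close>, leaves \<open>exp (2 * pi * (c - c0) * \<i>)\<close>.\<close>
    define phase where "phase = (\<lambda>y :: complex ^ 3. y $ 3 / z0 * exp (- (pi * (Re (y $ 1)) * Im (y $ 1) * \<i>)
        + pi / 2 * ((Re (y $ 1))\<^sup>2 + (Im (y $ 1))\<^sup>2) - 2 * pi * c0 * \<i>))"
    \<comment> \<open>The right half-plane keeps away from the branch cut, so that \<open>Ln\<close>
      is continuous and \<open>V\<close> is open.\<close>
    define V where "V = {w. 0 < Re w} \<inter> Ln -` {l. \<bar>Im l\<bar> < 2 * pi * \<epsilon>}"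
    have "open V"
      unfolding V_def
      by (intro continuous_open_preimage continuous_on_Ln open_halfspace_Re_gt open_Collect_less continuous_intros)
        (auto simp: complex_nonpos_Reals_iff)
    define U where "U = {y. \<bar>Re (y $ 1) - a0\<bar> < \<epsilon>} \<inter> {y. \<bar>- Im (y $ 1) - b0\<bar> < \<epsilon>} \<inter> phase -` V"
    have "continuous_on UNIV phase"
      unfolding phase_def using z0 by (intro continuous_intros) auto
    then have "open U"
      unfolding U_def by (intro open_Int open_vimage \<open>open V\<close> open_Collect_less continuous_intros)
    have phase: "phase (act a b c base_point) = exp (2 * pi * of_real (c - c0) * \<i>)" for a b c
    proof -
      have "phase (act a b c base_point)
          = exp (2 * pi * c * \<i> - pi * a * b * \<i> - pi / 2 * (a\<^sup>2 + b\<^sup>2))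
            * exp (- (pi * a * (- b) * \<i>) + pi / 2 * (a\<^sup>2 + b\<^sup>2) - 2 * pi * c0 * \<i>)"
        unfolding phase_def act_base_point z0_def[symmetric] using z0 by simp
      also have "\<dots> = exp (2 * pi * of_real (c - c0) * \<i>)"
        unfolding exp_add[symmetric] by (rule arg_cong[of _ _ exp]) (simp add: algebra_simps)
      finally show ?thesis .
    qed
    define N where "N = {g \<in> carrier (aut_group heis_domain). g ` {base_point} \<subseteq> U}"
    have "openin (aut_topology heis_domain) N"
      unfolding aut_topology_def N_def
      by (rule topology_generated_by_Basis) (use base_point_in \<open>open U\<close> compact_sing in blast)
    moreover have "act a0 b0 c0 base_point \<in> U"
      using \<open>0 < \<epsilon>\<close> by (simp add: U_def phase V_def) (simp add: act_base_point)
    then have "f \<in> N"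
      unfolding N_def f using aut_of_in_carrier[of "heisenberg_matrix a0 b0 c0"] base_point_in
      by (simp add: aut_of_heisenberg_matrix)
    moreover have "N \<subseteq> aut_iso ` O'"
    proof
      fix g assume g: "g \<in> N"
      then have "g \<in> aut_of ` ?C" unfolding aut_of_surj N_def by blast
      then obtain a b c where abc: "g = aut_of (heisenberg_matrix a b c)"
        by (auto simp: heisenberg_group_def)
      have inU: "act a b c base_point \<in> U"
        using g base_point_in by (simp add: N_def abc aut_of_heisenberg_matrix)
      then have "exp (2 * pi * of_real (c - c0) * \<i>) \<in> V" by (simp add: U_def phase)
      then obtain n :: int where n: "\<bar>c + of_int n - c0\<bar> < \<epsilon>"
        using phase_close[OF \<open>0 < \<epsilon>\<close>] unfolding V_def by blast
      moreover have "\<bar>a - a0\<bar> < \<epsilon>" "\<bar>b - b0\<bar> < \<epsilon>" using inU by (simp_all add: U_def act_base_point)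
      ultimately have "?q (heisenberg_matrix a b (c + of_int n)) \<in> O'" by (intro near)
      moreover have "aut_of (heisenberg_matrix a b (c + of_int n)) = g"
        unfolding abc aut_of_heisenberg_matrix by (intro restrict_ext) (rule act_shift_int)
      ultimately show "g \<in> aut_iso ` O'" using aut_iso_coset[OF m] by (metis imageI)
    qed
    ultimately show "\<exists>T. openin (aut_topology heis_domain) T \<and> f \<in> T \<and> T \<subseteq> aut_iso ` O'" by blast
  qed
qed

lemma homeomorphic_map_aut_iso: "homeomorphic_map G_topology (aut_topology heis_domain) aut_iso"
proof (rule bijective_open_imp_homeomorphic_map[OF _ open_map_aut_iso])
  let ?q = "\<lambda>A. heisenberg_subgroup #>\<^bsub>heisenberg_group\<^esub> A"
  have "continuous_map (top_of_set (carrier heisenberg_group)) (aut_topology heis_domain) (aut_iso \<circ> ?q)"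
    using continuous_map_eq[OF continuous_map_aut_of] aut_iso_coset by (simp add: o_def)
  then show "continuous_map G_topology (aut_topology heis_domain) aut_iso"
    unfolding G_topology_def by (rule continuous_compose_quotient_map[OF quotient_map_quotient_topology])
  have "bij_betw aut_iso (carrier G_group) (carrier (aut_group heis_domain))"
    using aut_iso_in_iso by (simp add: iso_def)
  then show "aut_iso ` topspace G_topology = topspace (aut_topology heis_domain)"
    "inj_on aut_iso (topspace G_topology)"
    by (simp_all add: bij_betw_def)
qed

theorem mainTheorem2:
  shows "\<exists>D :: (complex ^ 3) set. domain_of_bounded_type D \<and>
           topological_group_iso G_group G_topology (aut_group D) (aut_topology D) \<noteq> {}"
proof (intro exI conjI)
  show "domain_of_bounded_type heis_domain" by (rule bounded_type_heis_domain)
  have "aut_iso \<in> topological_group_iso G_group G_topology (aut_group heis_domain) (aut_topology heis_domain)"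
    using aut_iso_in_iso homeomorphic_map_aut_iso by (simp add: topological_group_iso_def)
  then show "topological_group_iso G_group G_topology (aut_group heis_domain) (aut_topology heis_domain) \<noteq> {}"
    by blast
qed

end
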